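(* Consider the problem $\min_{x\in\mathcal X} f(x)$, $f=\frac1n\sum_{i=1}^n f_i$, where $\mathcal X\subset\mathbb R^d$ is nonempty, convex and compact with $\|x-y\|\le D$ for all $x,y\in\mathcal X$; $f$ is $L$-smooth on $\mathcal X$; each $f_i$ is $L_i$-smooth on $\mathcal X$; and $f$ is convex on $\mathcal X$ (the individual $f_i$ need not be convex). Let $\tilde L^2=\frac1n\sum_{i=1}^n L_i^2$ and let $x^*$ be a minimizer of $f$ on $\mathcal X$. Run the Saga Sarah Frank-Wolfe algorithm (described in the context) with batch size $b$, momentum $\lambda=\frac b{2n}$ and, for a total number $K$ of iterations, the step sizes ($0\le k\le K-1$) $$\eta_k=\begin{cases}\dfrac b{4n}, & \text{if } K\le \dfrac{4n}b,\\[2mm] \dfrac b{4n}, & \text{if } K>\dfrac{4n}b \text{ and } k<\lceil K/2\rceil,\\[2mm] \dfrac{2}{8n/b+k-\lceil K/2\rceil}, & \text{if } K>\dfrac{4n}b\text{ and } k\ge\lceil K/2\rceil.\end{cases}$$ Then $\varepsilon$-suboptimality in expectation, i.e. $\mathbb E[f(x^K)-f(x^* )]\le\varepsilon$ for a suitable number of iterations $K=K(\varepsilon)$, is achieved with $$\mathcal O\left(\frac nb\log\frac1\varepsilon+\left[1+\frac{\tilde L\sqrt n}{bL}\right]\frac{LD^2}{\varepsilon}\right)\ \text{ LMO calls,}$$ and $$\mathcal O\left(n\log\frac1\varepsilon+\left[b+\frac{\tilde L\sqrt n}{L}\right]\frac{LD^2}{\varepsilon}\right)\ \text{ stochastic oracle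 calls.}$$
   Context: Norms and inner products are Euclidean and $[n]=\{1,\dots,n\}$. The $f_i$ are real-valued and differentiable on $\mathcal X$ (say, on an open neighbourhood of $\mathcal X$). A function $h$ is $M$-smooth on $\mathcal X$ ($M>0$) if $\|\nabla h(x)-\nabla h(y)\|\le M\|x-y\|$ for all $x,y\in\mathcal X$. Convexity of $f$ on $\mathcal X$ means $f(x)\ge f(y)+\langle\nabla f(y),x-y\rangle$ for all $x,y\in\mathcal X$. The constants satisfy $L,L_i,D>0$. Saga Sarah Frank-Wolfe algorithm. Parameters: step sizes $\{\eta_k\}$, momentum $\lambda$, integer batch size $b$ with $1\le b\le n$. Initialization: $x^0\in\mathcal X$ (deterministic), $g^0=\nabla f(x^0)$, $y_i^0=\nabla f_i(x^0)$ for $i\in[n]$. For $k=0,1,\dots,K-1$: (1) $s^k\in\arg\min_{s\in\mathcal X}\langle g^k,s\rangle$ (any minimizer, chosen as a measurable function of the past); (2) $x^{k+1}=x^k+\eta_k(s^k-x^k)$; (3) draw a batch $S_k$ of $b$ indices uniformly at random from $[n]$ (i.i.d., with repetitions counted in sums over $S_k$), independent of the past; (4) $g^{k+1}=\frac1b\sum_{i\in S_k}[\nabla f_i(x^{k+1})-\nabla f_i(x^k)]+(1-\lambda)g^k+\lambda\left(\frac1b\sum_{i\in S_k}[\nabla f_i(x^k)-y_i^k]+\frac1n\sum_{j=1}^n y_j^k\right)$; (5) $y_i^{k+1}=\nabla f_i(x^{k+1})$ if $i\in S_k$, and $y_i^{k+1}=y_i^k$ if $i\notin S_k$. Complexity measures.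 Each execution of step (1) is one LMO (linear minimization oracle) call, so $K$ iterations use $K$ LMO calls. A stochastic oracle call is one evaluation of a gradient $\nabla f_i$ at a point; the initialization costs $n$ calls and each iteration costs $2b$ calls. Meaning of $\mathcal O$: there is an absolute constant $C$ such that for every problem instance, $x^0$ and $b$ there is $\varepsilon_0>0$ such that for all $0<\varepsilon\le\varepsilon_0$ there is a $K$ achieving $\varepsilon$-suboptimality for which both counts are at most $C$ times the displayed expressions. *)

theory Defs
  imports "HOL-Probability.Probability"
begin

text \<open>
  The constant hidden in the \<open>\<O>\<close>-notation is absolute, hence must not depend on the dimension.
  A type-indexed \<open>real ^ 'd\<close> would put the existential quantifier over the constant inside the
  quantification over \<open>d\<close>. Therefore all spaces \<open>\<real>\<^sup>d\<close> are realised as the subspaces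
  \<open>Rd d\<close> of one inner product space, the finitely supported real sequences.
\<close>

typedef rseq = "{u :: nat \<Rightarrow> real. finite {i. u i \<noteq> 0}}"
  morphisms coord Abs_rseq
  by (rule exI[of _ "\<lambda>_. 0"]) simp

setup_lifting type_definition_rseq

lemma finite_coord [simp]: "finite {i. coord x i \<noteq> 0}"
  using coord[of x] by simp

lemma rseq_eq_iff: "x = y \<longleftrightarrow> (\<forall>i. coord x i = coord y i)"
  by (auto simp: coord_inject[symmetric] fun_eq_iff)

instantiation rseq :: real_vector
begin

lift_definition zero_rseq :: rseq is "\<lambda>_. 0" by simp

lift_definition plus_rseq :: "rseq \<Rightarrow> rseq \<Rightarrow> rseq" is "\<lambda>u v i. u i + v i"
  by (erule (1) finite_subset[OF _ finite_UnI, rotated]) auto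

lift_definition minus_rseq :: "rseq \<Rightarrow> rseq \<Rightarrow> rseq" is "\<lambda>u v i. u i - v i"
  by (erule (1) finite_subset[OF _ finite_UnI, rotated]) auto

lift_definition uminus_rseq :: "rseq \<Rightarrow> rseq" is "\<lambda>u i. - u i" by simp

lift_definition scaleR_rseq :: "real \<Rightarrow> rseq \<Rightarrow> rseq" is "\<lambda>c u i. c * u i" by simp

instance
  by standard (simp_all add: rseq_eq_iff plus_rseq.rep_eq zero_rseq.rep_eq minus_rseq.rep_eq
      uminus_rseq.rep_eq scaleR_rseq.rep_eq algebra_simps)

end

lemmas coord_simps [simp] = plus_rseq.rep_eq zero_rseq.rep_eq minus_rseq.rep_eq
  uminus_rseq.rep_eq scaleR_rseq.rep_eq

instantiation rseq :: real_inner
begin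

definition inner_rseq :: "rseq \<Rightarrow> rseq \<Rightarrow> real"
  where "inner_rseq x y = (\<Sum>i | coord x i \<noteq> 0. coord x i * coord y i)"

definition norm_rseq :: "rseq \<Rightarrow> real"
  where "norm_rseq x = sqrt (x \<bullet> x)"

definition sgn_rseq :: "rseq \<Rightarrow> rseq"
  where "sgn_rseq x = x /\<^sub>R norm x"

definition dist_rseq :: "rseq \<Rightarrow> rseq \<Rightarrow> real"
  where "dist_rseq x y = norm (x - y)"

definition uniformity_rseq :: "(rseq \<times> rseq) filter"
  where "uniformity_rseq = (INF e\<in>{0<..}. principal {(x, y). dist x y < e})"

definition open_rseq :: "rseq set \<Rightarrow> bool"
  where "open_rseq U \<longleftrightarrow> (\<forall>x\<in>U. eventually (\<lambda>(x', y). x' = x \<longrightarrow> y \<in> U) uniformity)"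

lemma inner_rseq_superset:
  assumes "finite A" "{i. coord x i \<noteq> 0} \<subseteq> A"
  shows "x \<bullet> y = (\<Sum>i\<in>A. coord x i * coord y i)"
  unfolding inner_rseq_def by (rule sum.mono_neutral_left) (use assms in auto)

instance
proof
  fix x y z :: rseq and r :: real
  define A where "A = {i. coord x i \<noteq> 0} \<union> {i. coord y i \<noteq> 0} \<union> {i. coord z i \<noteq> 0}"
  have A: "finite A" by (simp add: A_def)
  have sub: "{i. coord x i \<noteq> 0} \<subseteq> A" "{i. coord y i \<noteq> 0} \<subseteq> A"
    "{i. coord (x + y) i \<noteq> 0} \<subseteq> A" "{i. coord (r *\<^sub>R x) i \<noteq> 0} \<subseteq> A"
    by (auto simp: A_def)
  note S = inner_rseq_superset[OF A]
  show "x \<bullet> y = y \<bullet> x"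
    by (simp add: S[OF sub(1)] S[OF sub(2)] mult.commute)
  show "(x + y) \<bullet> z = x \<bullet> z + y \<bullet> z"
    by (simp add: S[OF sub(1)] S[OF sub(2)] S[OF sub(3)] sum.distrib algebra_simps)
  show "(r *\<^sub>R x) \<bullet> y = r * (x \<bullet> y)"
    by (simp add: S[OF sub(1)] S[OF sub(4)] sum_distrib_left mult.assoc)
  show "0 \<le> x \<bullet> x"
    by (simp add: inner_rseq_def sum_nonneg)
  show "x \<bullet> x = 0 \<longleftrightarrow> x = 0"
    by (auto simp: inner_rseq_def sum_nonneg_eq_0_iff rseq_eq_iff)
  show "norm x = sqrt (x \<bullet> x)" by (rule norm_rseq_def)
  show "sgn x = x /\<^sub>R norm x" by (rule sgn_rseq_def)
  show "dist x y = norm (x - y)" by (rule dist_rseq_def)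
  show "uniformity = (INF e\<in>{0<..}. principal {(x, y :: rseq). dist x y < e})"
    by (rule uniformity_rseq_def)
  show "open U \<longleftrightarrow> (\<forall>x\<in>U. eventually (\<lambda>(x', y). x' = x \<longrightarrow> y \<in> U) uniformity)"
    for U :: "rseq set" by (rule open_rseq_def)
qed

end

definition Rd :: "nat \<Rightarrow> rseq set"
  where "Rd d = {x. \<forall>i\<ge>d. coord x i = 0}"

lemma inner_Rd: "x \<in> Rd d \<Longrightarrow> x \<bullet> y = (\<Sum>i<d. coord x i * coord y i)"
  by (rule inner_rseq_superset) (auto simp: Rd_def not_le[symmetric])

lemma norm_Rd: "x \<in> Rd d \<Longrightarrow> norm x = sqrt (\<Sum>i<d. (coord x i)\<^sup>2)"
  by (simp add: norm_rseq_def inner_Rd power2_eq_square)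

lemma subspace_Rd: "subspace (Rd d)"
  by (auto simp: subspace_def Rd_def)

text \<open>
  Functions on \<open>\<real>\<^sup>d\<close> are total functions on the ambient type; only their values on \<open>Rd d\<close> matter.
\<close>

definition has_gradient :: "nat \<Rightarrow> (rseq \<Rightarrow> real) \<Rightarrow> rseq \<Rightarrow> rseq \<Rightarrow> bool"
  where "has_gradient d h x G \<longleftrightarrow> G \<in> Rd d \<and> (h has_derivative (\<lambda>v. G \<bullet> v)) (at x within Rd d)"

definition gradient :: "nat \<Rightarrow> (rseq \<Rightarrow> real) \<Rightarrow> rseq \<Rightarrow> rseq"
  where "gradient d h x = (THE G. has_gradient d h x G)"

lemma has_gradient_unique:
  assumes "x \<in> Rd d" "has_gradient d h x G" "has_gradient d h x G'"
  shows "G = G'"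
proof -
  define v where "v = G - G'"
  have v: "v \<in> Rd d"
    using assms(2,3) subspace_diff[OF subspace_Rd] by (auto simp: v_def has_gradient_def)
  have line: "((\<lambda>t. x + t *\<^sub>R v) has_derivative (\<lambda>t. t *\<^sub>R v)) (at 0)"
    by (auto intro!: derivative_eq_intros)
  have img: "(\<lambda>t. x + t *\<^sub>R v) ` UNIV \<subseteq> Rd d"
    using assms(1) v subspace_Rd by (auto intro!: subspace_add subspace_scale)
  have D: "((\<lambda>t. h (x + t *\<^sub>R v)) has_derivative (\<lambda>t. H \<bullet> (t *\<^sub>R v))) (at (0 :: real))"
    if "has_gradient d h x H" for H
  proof -
    have "(h has_derivative (\<lambda>v. H \<bullet> v)) (at (x + 0 *\<^sub>R v) within (\<lambda>t. x + t *\<^sub>R v) ` UNIV)"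
      using that img has_derivative_subset unfolding has_gradient_def by auto
    from has_derivative_in_compose[OF line this] show ?thesis by simp
  qed
  from has_derivative_unique[OF D[OF assms(2)] D[OF assms(3)]]
  have "G \<bullet> (1 *\<^sub>R v) = G' \<bullet> (1 *\<^sub>R v)" by metis
  then have "v \<bullet> v = 0" by (simp add: v_def inner_diff_left)
  then show ?thesis by (simp add: v_def)
qed

lemma gradient_eqI:
  assumes "x \<in> Rd d" "has_gradient d h x G"
  shows "gradient d h x = G"
  unfolding gradient_def using assms has_gradient_unique by blast

definition differentiable_near :: "nat \<Rightarrow> rseq set \<Rightarrow> (rseq \<Rightarrow> real) \<Rightarrow> bool"
  where "differentiable_near d X h \<longleftrightarrow>
    (\<exists>U. openin (top_of_set (Rd d)) U \<and> X \<subseteq> U \<and> (\<forall>x\<in>U. \<exists>G. has_gradient d h x G))"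

definition smooth_wrt :: "nat \<Rightarrow> real \<Rightarrow> rseq set \<Rightarrow> (rseq \<Rightarrow> real) \<Rightarrow> bool"
  where "smooth_wrt d M X h \<longleftrightarrow> M > 0 \<and>
    (\<forall>x\<in>X. \<forall>y\<in>X. norm (gradient d h x - gradient d h y) \<le> M * norm (x - y))"

definition gradient_convex :: "nat \<Rightarrow> rseq set \<Rightarrow> (rseq \<Rightarrow> real) \<Rightarrow> bool"
  where "gradient_convex d X h \<longleftrightarrow>
    (\<forall>x\<in>X. \<forall>y\<in>X. h x \<ge> h y + gradient d h y \<bullet> (x - y))"

definition avg :: "nat \<Rightarrow> (nat \<Rightarrow> rseq \<Rightarrow> real) \<Rightarrow> rseq \<Rightarrow> real"
  where "avg n f x = (1 / real n) * (\<Sum>i=1..n. f i x)"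

definition fw_problem ::
  "nat \<Rightarrow> nat \<Rightarrow> rseq set \<Rightarrow> (nat \<Rightarrow> rseq \<Rightarrow> real) \<Rightarrow> real \<Rightarrow> (nat \<Rightarrow> real) \<Rightarrow> real \<Rightarrow> bool"
  where "fw_problem d n X f L Ls D \<longleftrightarrow>
    n \<ge> 1 \<and>
    X \<subseteq> Rd d \<and> X \<noteq> {} \<and> convex X \<and> compact X \<and>
    D > 0 \<and> (\<forall>x\<in>X. \<forall>y\<in>X. norm (x - y) \<le> D) \<and>
    (\<forall>i\<in>{1..n}. differentiable_near d X (f i)) \<and>
    smooth_wrt d L X (avg n f) \<and>
    (\<forall>i\<in>{1..n}. smooth_wrt d (Ls i) X (f i)) \<and>
    gradient_convex d X (avg n f)"

definition L_tilde :: "nat \<Rightarrow> (nat \<Rightarrow> real) \<Rightarrow> real"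
  where "L_tilde n Ls = sqrt ((1 / real n) * (\<Sum>i=1..n. (Ls i)\<^sup>2))"

text \<open>
  The only randomness is in the batches. An outcome \<open>\<omega>\<close> lists them: \<open>\<omega> k j\<close> is the \<open>j\<close>-th index
  drawn in iteration \<open>k\<close> (\<open>j < b\<close>), so that a sum over \<open>S\<^sub>k\<close> is a sum over \<open>j < b\<close>, with
  repetitions. All draws are independent and uniform on \<open>{1..n}\<close>; the outcomes for \<open>k \<ge> K\<close> or
  \<open>j \<ge> b\<close> are dummies.
\<close>

definition batches :: "nat \<Rightarrow> nat \<Rightarrow> nat \<Rightarrow> (nat \<Rightarrow> nat \<Rightarrow> nat) pmf"
  where "batches n b K =
    Pi_pmf {..<K} (\<lambda>_. 0) (\<lambda>_. Pi_pmf {..<b} 0 (\<lambda>_. pmf_of_set {1..n}))"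

text \<open>
  The processes \<open>x\<close>, \<open>g\<close>, \<open>y\<close>, \<open>s\<close> are functions of the outcome. The last conjunct says that the
  LMO answer \<open>s k\<close> is determined by the batches drawn before iteration \<open>k\<close>; as the probability space
  is discrete, every such function is measurable, and \<open>x\<close>, \<open>g\<close>, \<open>y\<close> and earlier \<open>s\<close> are functions
  of the same batches.
\<close>

definition saga_sarah_fw_run ::
  "nat \<Rightarrow> nat \<Rightarrow> rseq set \<Rightarrow> (nat \<Rightarrow> rseq \<Rightarrow> real) \<Rightarrow> rseq \<Rightarrow> nat \<Rightarrow> real \<Rightarrow> (nat \<Rightarrow> real) \<Rightarrow> nat \<Rightarrow>
   (nat \<Rightarrow> (nat \<Rightarrow> nat \<Rightarrow> nat) \<Rightarrow> rseq) \<Rightarrow> (nat \<Rightarrow> (nat \<Rightarrow> nat \<Rightarrow> nat) \<Rightarrow> rseq) \<Rightarrow>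
   (nat \<Rightarrow> nat \<Rightarrow> (nat \<Rightarrow> nat \<Rightarrow> nat) \<Rightarrow> rseq) \<Rightarrow> (nat \<Rightarrow> (nat \<Rightarrow> nat \<Rightarrow> nat) \<Rightarrow> rseq) \<Rightarrow> bool"
  where "saga_sarah_fw_run d n X f x0 b lam \<eta> K x g y s \<longleftrightarrow>
    (\<forall>\<omega>\<in>set_pmf (batches n b K).
      x 0 \<omega> = x0 \<and>
      g 0 \<omega> = gradient d (avg n f) x0 \<and>
      (\<forall>i\<in>{1..n}. y 0 i \<omega> = gradient d (f i) x0) \<and>
      (\<forall>k<K.
        is_arg_min (\<lambda>v. g k \<omega> \<bullet> v) (\<lambda>v. v \<in> X) (s k \<omega>) \<and>
        x (Suc k) \<omega> = x k \<omega> + \<eta> k *\<^sub>R (s k \<omega> - x k \<omega>) \<and>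
        g (Suc k) \<omega> =
          (1 / real b) *\<^sub>R
            (\<Sum>j<b. gradient d (f (\<omega> k j)) (x (Suc k) \<omega>) - gradient d (f (\<omega> k j)) (x k \<omega>))
          + (1 - lam) *\<^sub>R g k \<omega>
          + lam *\<^sub>R
            ((1 / real b) *\<^sub>R (\<Sum>j<b. gradient d (f (\<omega> k j)) (x k \<omega>) - y k (\<omega> k j) \<omega>)
             + (1 / real n) *\<^sub>R (\<Sum>i=1..n. y k i \<omega>)) \<and>
        (\<forall>i\<in>{1..n}. y (Suc k) i \<omega> =
          (if i \<in> \<omega> k ` {..<b} then gradient d (f i) (x (Suc k) \<omega>) else y k i \<omega>)))) \<and>
    (\<forall>k<K. \<exists>\<sigma>. \<forall>\<omega>\<in>set_pmf (batches n b K). s k \<omega> = \<sigma> (restrict \<omega> {..<k}))"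

definition step_size :: "nat \<Rightarrow> nat \<Rightarrow> nat \<Rightarrow> nat \<Rightarrow> real"
  where "step_size n b K k =
    (if real K \<le> 4 * real n / real b then real b / (4 * real n)
     else if int k < \<lceil>real K / 2\<rceil> then real b / (4 * real n)
     else 2 / (8 * real n / real b + real k - of_int \<lceil>real K / 2\<rceil>))"

definition lmo_calls :: "nat \<Rightarrow> nat"
  where "lmo_calls K = K"

definition oracle_calls :: "nat \<Rightarrow> nat \<Rightarrow> nat \<Rightarrow> nat"
  where "oracle_calls n b K = n + 2 * b * K"

end

theory Submission
  imports Defs
begin

text \<open>
  Write \<open>a = 8 n / b\<close>, so that the momentum is \<open>4 / a\<close> and the step size is \<open>2 / a\<close> in the first half of
  the run and \<open>2 / (a + j)\<close> in iteration \<open>j\<close> of the second half.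

  The argument balances three quantities: the suboptimality \<open>F\<^sub>k\<close>, the error \<open>e\<^sub>k\<close> of the
  gradient estimator, and the staleness of the stored gradients (the mean square distance between
  the stored and the current component gradients). Smoothness, convexity and the optimality of the
  linear minimization give
  \<open>F\<^sub>k\<^sub>+\<^sub>1 \<le> (1 - \<eta>\<^sub>k) F\<^sub>k + \<eta>\<^sub>k D \<parallel>e\<^sub>k\<parallel> + L D\<^sup>2 \<eta>\<^sub>k\<^sup>2 / 2\<close> (lemma \<open>frank_wolfe_progress\<close>).
  Conditionally on the past, \<open>e\<^sub>k\<^sub>+\<^sub>1\<close> is the damped old error plus an average of \<open>b\<close> independent
  centred vectors (\<open>err_resampled\<close>), and a stored gradient is refreshed with probability at least
  \<open>b / (2 n)\<close> (\<open>staleness_resampled\<close>). A suitable combination \<open>V\<close> of mean square error and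
  staleness therefore satisfies \<open>V\<^sub>k\<^sub>+\<^sub>1 \<le> (1 - 1 / a) V\<^sub>k + 18 M\<^sup>2 D\<^sup>2 \<eta>\<^sub>k\<^sup>2 / b\<close> with
  \<open>M = L_tilde n Ls\<close> (\<open>V_Suc_le\<close>). As the step sizes vary slowly on the time scale \<open>a\<close>, the
  root mean square of \<open>e\<^sub>k\<close> is at most \<open>63 (M sqrt n / b) D \<eta>\<^sub>k\<close> (\<open>mean_square_err_le\<close>).

  Inserting this bound, the expected suboptimality obeys
  \<open>F\<^sub>k\<^sub>+\<^sub>1 \<le> (1 - \<eta>\<^sub>k) F\<^sub>k + Q D\<^sup>2 \<eta>\<^sub>k\<^sup>2\<close> with \<open>Q = L / 2 + 63 M sqrt n / b\<close>, and the two-phase step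
  sizes turn this into \<open>F\<^sub>K \<le> 2 exp (- K / a) F\<^sub>0 + 16 Q D\<^sup>2 / K\<close>
  (\<open>suboptimality_recursion_bound\<close>). Taking \<open>K\<close> to be \<open>2 a ln (1 / \<epsilon>) + 32 Q D\<^sup>2 / \<epsilon>\<close>, rounded up,
  gives both complexity bounds.

  Conditional expectations are replaced by redrawing a single batch (\<open>expectation_resample\<close>), and
  all expectations are finite sums.
\<close>

section \<open>Recursive inequalities with two-phase step sizes\<close>

text \<open>
  If a quantity contracts at rate \<open>1 / a\<close> and is fed by \<open>c \<eta>\<^sub>k\<^sup>2\<close>, it stays of order
  \<open>a c \<eta>\<^sub>k\<^sup>2\<close>. The comparison sequence \<open>6 / (3 a + (k - h))\<close> lies between \<open>\<eta>\<^sub>k\<close> and \<open>3 \<eta>\<^sub>k\<close>; the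
  larger offset \<open>3 a\<close> is needed because the square of \<open>\<eta>\<^sub>k\<close> itself may shrink by a factor
  close to \<open>1 - 2 / a\<close>, faster than the contraction. The truncated subtraction \<open>k - h\<close> makes
  the step size constant up to \<open>k = h\<close>.
\<close>

lemma error_recursion_bound:
  fixes V \<eta> :: "nat \<Rightarrow> real"
  assumes a: "a \<ge> 1" and c: "c \<ge> 0" and V0: "V 0 \<le> 0"
    and rec: "\<And>k. k < K \<Longrightarrow> V (Suc k) \<le> (1 - 1 / a) * V k + c * (\<eta> k)\<^sup>2"
    and \<eta>: "\<And>k. k < K \<Longrightarrow> \<eta> k = 2 / (a + real (k - h))"
    and "k \<le> K"
  shows "V k \<le> 3 * a * c * (6 / (3 * a + real (k - h)))\<^sup>2"
  using \<open>k \<le> K\<close>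
proof (induction k)
  case 0
  show ?case
    by (rule order_trans[OF V0]) (use a c in auto)
next
  case (Suc k)
  define u where "u = 3 * a + real (k - h)"
  define w where "w = 3 * a + real (Suc k - h)"
  have u: "u \<ge> 3 * a" "u > 0" and w: "w > 0" "w \<le> u + 1" "u \<le> w"
    using a by (auto simp: u_def w_def)
  have "2 / (a + real (k - h)) \<le> 6 / u"
    using a by (simp add: u_def field_simps)
  then have "\<eta> k \<le> 6 / u" "0 \<le> \<eta> k"
    using Suc.prems a \<eta>[of k] by auto
  then have \<eta>2: "(\<eta> k)\<^sup>2 \<le> (6 / u)\<^sup>2"
    by (rule power_mono)
  have decay: "(1 - 2 / (3 * a)) * (6 / u)\<^sup>2 \<le> (6 / w)\<^sup>2"
  proof -
    have "(1 - 2 / (3 * a)) \<le> 1 - 2 / u"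
      using u a by (simp add: frac_le)
    also have "\<dots> \<le> (u / (u + 1))\<^sup>2"
    proof -
      have "(1 - 2 / u) * (u + 1)\<^sup>2 \<le> u\<^sup>2"
        using u by (simp add: field_simps power2_eq_square)
      then show ?thesis
        using u by (simp add: power_divide pos_le_divide_eq)
    qed
    also have "\<dots> \<le> (u / w)\<^sup>2"
      by (rule power_mono) (use u w in \<open>auto intro: divide_left_mono\<close>)
    finally have "(1 - 2 / (3 * a)) * (6 / u)\<^sup>2 \<le> (u / w)\<^sup>2 * (6 / u)\<^sup>2"
      by (rule mult_right_mono) simp
    then show ?thesis
      using u by (simp add: power_divide)
  qed
  have "V (Suc k) \<le> (1 - 1 / a) * V k + c * (\<eta> k)\<^sup>2"
    using Suc.prems by (intro rec) auto
  also have "\<dots> \<le> (1 - 1 / a) * (3 * a * c * (6 / u)\<^sup>2) + c * (6 / u)\<^sup>2"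
    using Suc a c \<eta>2 by (intro add_mono mult_left_mono) (auto simp: u_def)
  also have "\<dots> = 3 * a * c * ((1 - 2 / (3 * a)) * (6 / u)\<^sup>2)"
  proof -
    have "(1 - 1 / a) * (3 * a * c * z) + c * z = 3 * a * c * ((1 - 2 / (3 * a)) * z)" for z
      using a by (simp add: field_simps)
    then show ?thesis .
  qed
  also have "\<dots> \<le> 3 * a * c * (6 / w)\<^sup>2"
    using decay a c by (intro mult_left_mono) auto
  finally show ?case by (simp add: w_def)
qed

text \<open>
  The first half of the iterations, with constant step size \<open>2 / a\<close>, reduces \<open>F 0\<close> geometrically
  down to a floor of \<open>2 q / a\<close>. In the second half the decreasing steps remove this floor at
  rate \<open>1 / K\<close>: multiplying the recursion by \<open>(a + j) (a + j - 1)\<close> makes it telescope.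
\<close>

lemma suboptimality_recursion_bound:
  fixes F \<eta> :: "nat \<Rightarrow> real"
  assumes a: "a \<ge> 8" and q: "q \<ge> 0" and F0: "F 0 \<ge> 0" and K: "K > 0"
    and rec: "\<And>k. k < K \<Longrightarrow> F (Suc k) \<le> (1 - \<eta> k) * F k + q * (\<eta> k)\<^sup>2"
    and \<eta>: "\<And>k. k < K \<Longrightarrow> \<eta> k = 2 / (a + real (k - (K + 1) div 2))"
  shows "F K \<le> 2 * exp (- real K / a) * F 0 + 16 * q / real K"
proof -
  define h where "h = (K + 1) div 2"
  have h: "h \<le> K" "K \<le> 2 * h" "K \<le> 2 * (K - h) + 1"
    using K by (auto simp: h_def)
  have phase1: "F k \<le> (1 - 2 / a) ^ k * F 0 + 2 * q / a" if "k \<le> h" for k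
    using that
  proof (induction k)
    case 0
    then show ?case using a q by simp
  next
    case (Suc k)
    have \<eta>k: "\<eta> k = 2 / a"
      using Suc.prems h \<eta>[of k] by (simp add: h_def)
    have "F (Suc k) \<le> (1 - 2 / a) * F k + q * (2 / a)\<^sup>2"
      using rec[of k] Suc.prems h by (simp add: \<eta>k)
    also have "\<dots> \<le> (1 - 2 / a) * ((1 - 2 / a) ^ k * F 0 + 2 * q / a) + q * (2 / a)\<^sup>2"
      using Suc a by (intro add_right_mono mult_left_mono) auto
    also have "\<dots> = (1 - 2 / a) ^ Suc k * F 0 + 2 * q / a"
      using a by (simp add: field_simps power2_eq_square)
    finally show ?case .
  qed
  have Fh: "F h \<le> exp (- real K / a) * F 0 + 2 * q / a"
  proof -
    have "(1 - 2 / a) ^ h \<le> exp (- (2 / a)) ^ h"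
      using a exp_ge_add_one_self[of "- (2 / a)"] by (intro power_mono) auto
    also have "\<dots> = exp (- (2 * real h / a))"
      by (simp flip: exp_of_nat_mult)
    also have "\<dots> \<le> exp (- real K / a)"
      using h a by (simp add: field_simps)
    finally show ?thesis
      using phase1[of h] mult_right_mono[OF _ F0] by fastforce
  qed
  have phase2: "(a + real j - 1) * (a + real j - 2) * F (h + j)
      \<le> (a - 1) * (a - 2) * F h + 4 * q * real j" if "h + j \<le> K" for j
    using that
  proof (induction j)
    case 0
    then show ?case by simp
  next
    case (Suc j)
    define t where "t = a + real j"
    have t: "t \<ge> 8" using a by (simp add: t_def)
    have "F (Suc (h + j)) \<le> (1 - 2 / t) * F (h + j) + q * (2 / t)\<^sup>2"
      using rec[of "h + j"] \<eta>[of "h + j"] Suc.prems by (simp add: t_def h_def)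
    then have "t * (t - 1) * F (Suc (h + j))
        \<le> t * (t - 1) * ((1 - 2 / t) * F (h + j) + q * (2 / t)\<^sup>2)"
      using t by (intro mult_left_mono) auto
    also have "\<dots> = (t - 1) * (t - 2) * F (h + j) + 4 * q * ((t - 1) / t)"
      using t by (simp add: field_simps power2_eq_square)
    also have "\<dots> \<le> (t - 1) * (t - 2) * F (h + j) + 4 * q * 1"
      using t q by (intro add_left_mono mult_left_mono) auto
    also have "\<dots> \<le> (a - 1) * (a - 2) * F h + 4 * q * real j + 4 * q"
      using Suc by (simp add: t_def)
    finally show ?case
      by (simp add: t_def algebra_simps)
  qed
  define J where "J = K - h"
  define t where "t = a + real J"
  define E where "E = exp (- real K / a) * F 0"
  have E: "E \<ge> 0" using F0 by (simp add: E_def)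
  have t: "t \<ge> a" "t \<ge> 8" "real K / 2 \<le> t" "real J \<le> t"
    using a h by (auto simp: t_def J_def of_nat_diff)
  have "(t - 1) * (t - 2) * F K \<le> (a - 1) * (a - 2) * F h + 4 * q * real J"
    using phase2[of J] h by (simp add: t_def J_def)
  also have "\<dots> \<le> (a - 1) * (a - 2) * (E + 2 * q / a) + 4 * q * real J"
    using Fh a by (intro add_right_mono mult_left_mono) (auto simp: E_def)
  also have "\<dots> \<le> a * a * (E + 2 * q / a) + 4 * q * real J"
    using a q E by (intro add_right_mono mult_right_mono mult_mono) auto
  also have "\<dots> = a * a * E + q * (2 * a + 4 * real J)"
    using a by (simp add: field_simps)
  also have "\<dots> \<le> t * t * E + q * (4 * t)"
    using a q E t by (intro add_mono mult_right_mono mult_left_mono mult_mono) (auto simp: t_def)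
  finally have main: "(t - 1) * (t - 2) * F K \<le> t * t * E + 4 * q * t"
    by simp
  have den: "t * t / 2 \<le> (t - 1) * (t - 2)"
  proof -
    have "8 * t \<le> t * t" using t by (intro mult_right_mono) auto
    moreover have "(t - 1) * (t - 2) = t * t - 3 * t + 2" by (simp add: algebra_simps)
    ultimately show ?thesis using t by linarith
  qed
  have FK: "F K \<le> 2 * E + 8 * q / t"
  proof (cases "F K \<le> 0")
    case True
    moreover have "0 \<le> 2 * E + 8 * q / t" using E q t by simp
    ultimately show ?thesis by linarith
  next
    case False
    then have "t * t / 2 * F K \<le> t * t * E + 4 * q * t"
      using order_trans[OF mult_right_mono[OF den, of "F K"] main] by simp
    also have "\<dots> = t * t / 2 * (2 * E + 8 * q / t)"
      using t by (simp add: field_simps)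
    finally show ?thesis
      using t by (simp add: mult_le_cancel_left_pos)
  qed
  also have "8 * q / t \<le> 8 * q / (real K / 2)"
    using t q K by (intro divide_left_mono) auto
  finally show ?thesis by (simp add: E_def)
qed

text \<open>
  In the regime \<open>K > 4 n / b\<close> the two remaining cases of the step size rule are one
  formula, again by truncated subtraction.
\<close>

lemma step_size_eq:
  assumes "real K > 4 * real n / real b" "b \<ge> 1" "n \<ge> 1"
  shows "step_size n b K k = 2 / (8 * real n / real b + real (k - (K + 1) div 2))"
proof -
  have c: "\<lceil>real K / 2\<rceil> = int ((K + 1) div 2)"
  proof (rule ceiling_unique)
    have "K \<le> 2 * ((K + 1) div 2)" "2 * ((K + 1) div 2) < K + 2" by simp_all
    then have "real K \<le> 2 * real ((K + 1) div 2)" "2 * real ((K + 1) div 2) < real K + 2"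
      by linarith+
    then show "real_of_int (int ((K + 1) div 2)) - 1 < real K / 2"
      "real K / 2 \<le> real_of_int (int ((K + 1) div 2))" by simp_all
  qed
  show ?thesis
  proof (cases "k < (K + 1) div 2")
    case True
    then show ?thesis using assms by (simp add: step_size_def c field_simps)
  next
    case False
    then show ?thesis using assms by (simp add: step_size_def c of_nat_diff field_simps)
  qed
qed

section \<open>Averages over independent uniform batches\<close>

text \<open>
  The distribution of one batch: \<open>b\<close> independent uniform indices from \<open>{1..n}\<close>; positions from \<open>b\<close>
  on carry the default value \<open>0\<close>. It is the marginal of \<open>batches\<close> at each iteration.
\<close>

definition draws :: "nat \<Rightarrow> nat \<Rightarrow> (nat \<Rightarrow> nat) pmf"
  where "draws n b = Pi_pmf {..<b} 0 (\<lambda>_. pmf_of_set {1..n})"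

lemma finite_set_draws [simp]: "n \<ge> 1 \<Longrightarrow> finite (set_pmf (draws n b))"
  unfolding draws_def
  by (subst set_Pi_pmf) (auto intro!: finite_PiE_dflt simp: set_pmf_of_set)

lemma draws_range: "n \<ge> 1 \<Longrightarrow> v \<in> set_pmf (draws n b) \<Longrightarrow> j < b \<Longrightarrow> v j \<in> {1..n}"
  unfolding draws_def by (subst (asm) set_Pi_pmf) (auto simp: PiE_dflt_def set_pmf_of_set)

lemma finite_set_batches [simp]: "n \<ge> 1 \<Longrightarrow> finite (set_pmf (batches n b K))"
  unfolding batches_def draws_def[symmetric]
  by (subst set_Pi_pmf) (auto intro!: finite_PiE_dflt)

lemma integrable_batches [simp]:
  fixes h :: "_ \<Rightarrow> real" shows "n \<ge> 1 \<Longrightarrow> integrable (measure_pmf (batches n b K)) h"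
  by (rule integrable_measure_pmf_finite) simp

lemma integrable_draws [simp]:
  fixes h :: "_ \<Rightarrow> real" shows "n \<ge> 1 \<Longrightarrow> integrable (measure_pmf (draws n b)) h"
  by (rule integrable_measure_pmf_finite) simp

lemma batches_range: "k < K \<Longrightarrow> w \<in> set_pmf (batches n b K) \<Longrightarrow> w k \<in> set_pmf (draws n b)"
  unfolding batches_def draws_def[symmetric]
  by (subst (asm) set_Pi_pmf) (auto simp: PiE_dflt_def)

lemma batches_update:
  "k < K \<Longrightarrow> w \<in> set_pmf (batches n b K) \<Longrightarrow> v \<in> set_pmf (draws n b) \<Longrightarrow>
    w(k := v) \<in> set_pmf (batches n b K)"
  unfolding batches_def draws_def[symmetric]
  by (subst (asm) set_Pi_pmf, simp, subst set_Pi_pmf) (auto simp: PiE_dflt_def)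

lemma expectation_bind_finite:
  fixes h :: "'b \<Rightarrow> real"
  assumes "finite (set_pmf p)" "\<And>a. a \<in> set_pmf p \<Longrightarrow> finite (set_pmf (q a))"
  shows "measure_pmf.expectation (bind_pmf p q) h =
    measure_pmf.expectation p (\<lambda>a. measure_pmf.expectation (q a) h)"
  using assms pmf_expectation_bind[of "set_pmf p" q p h]
  by (simp add: integral_measure_pmf[of "set_pmf p"])

text \<open>
  Independence of the \<open>k\<close>-th batch from all others: drawing it again does not change the
  distribution. Averaging over the new draw \<open>v\<close> with the rest of \<open>w\<close> held fixed plays the role
  of a conditional expectation.
\<close>

lemma expectation_resample:
  fixes h :: "(nat \<Rightarrow> nat \<Rightarrow> nat) \<Rightarrow> real"
  assumes n: "n \<ge> 1" and k: "k < K"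
  shows "measure_pmf.expectation (batches n b K) h =
    measure_pmf.expectation (batches n b K)
      (\<lambda>w. measure_pmf.expectation (draws n b) (\<lambda>v. h (w(k := v))))"
proof -
  define R where "R = Pi_pmf ({..<K} - {k}) (\<lambda>_. 0) (\<lambda>_. draws n b)"
  have K: "{..<K} = insert k ({..<K} - {k})" using k by auto
  \<comment> \<open>Draw the \<open>k\<close>-th batch last; a second draw then overwrites the first.\<close>
  have eq: "batches n b K = bind_pmf R (\<lambda>w. map_pmf (\<lambda>v. w(k := v)) (draws n b))"
    unfolding batches_def draws_def[symmetric]
    by (subst K, subst Pi_pmf_insert')
      (simp_all add: R_def map_pmf_def bind_commute_pmf[of "draws n b"])
  have "batches n b K =
      bind_pmf (batches n b K) (\<lambda>w. map_pmf (\<lambda>v. w(k := v)) (draws n b))"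
    by (simp add: eq map_pmf_def bind_assoc_pmf bind_return_pmf)
  then have "measure_pmf.expectation (batches n b K) h = measure_pmf.expectation
      (bind_pmf (batches n b K) (\<lambda>w. map_pmf (\<lambda>v. w(k := v)) (draws n b))) h"
    by simp
  also have "\<dots> = measure_pmf.expectation (batches n b K)
      (\<lambda>w. measure_pmf.expectation (draws n b) (\<lambda>v. h (w(k := v))))"
    using n by (subst expectation_bind_finite) auto
  finally show ?thesis .
qed

lemma expectation_draws_Suc:
  fixes h :: "(nat \<Rightarrow> nat) \<Rightarrow> real"
  assumes n: "n \<ge> 1"
  shows "measure_pmf.expectation (draws n (Suc b)) h =
    (1 / real n) * (\<Sum>i=1..n. measure_pmf.expectation (draws n b) (\<lambda>v. h (v(b := i))))"
proof -
  have "draws n (Suc b) =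
      bind_pmf (pmf_of_set {1..n}) (\<lambda>i. map_pmf (\<lambda>v. v(b := i)) (draws n b))"
    unfolding draws_def lessThan_Suc by (subst Pi_pmf_insert') (simp_all add: map_pmf_def)
  then have "measure_pmf.expectation (draws n (Suc b)) h = measure_pmf.expectation
      (pmf_of_set {1..n}) (\<lambda>i. measure_pmf.expectation (draws n b) (\<lambda>v. h (v(b := i))))"
    using n by (simp add: expectation_bind_finite set_pmf_of_set)
  also have "\<dots> = (1 / real n) *
      (\<Sum>i=1..n. measure_pmf.expectation (draws n b) (\<lambda>v. h (v(b := i))))"
    using n by (subst integral_pmf_of_set) auto
  finally show ?thesis .
qed

text \<open>
  Independent centred summands are orthogonal in expectation. The offset \<open>c\<close> is what allows an
  induction over the number of draws, as it absorbs the latest draw.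
\<close>

lemma expectation_draws_norm_sum:
  fixes Z :: "nat \<Rightarrow> 'a :: real_inner"
  assumes n: "n \<ge> 1" and Z: "(\<Sum>i=1..n. Z i) = 0"
  shows "measure_pmf.expectation (draws n b) (\<lambda>v. (norm (c + (\<Sum>j<b. Z (v j))))\<^sup>2) =
    (norm c)\<^sup>2 + real b * ((1 / real n) * (\<Sum>i=1..n. (norm (Z i))\<^sup>2))"
proof (induction b arbitrary: c)
  case 0
  show ?case by simp
next
  case (Suc b)
  have upd: "c + (\<Sum>j<Suc b. Z ((v(b := i)) j)) = (c + Z i) + (\<Sum>j<b. Z (v j))" for v i
    by simp
  have "(\<Sum>i=1..n. (norm (c + Z i))\<^sup>2) = (\<Sum>i=1..n. (norm c)\<^sup>2 + 2 * (c \<bullet> Z i) + (norm (Z i))\<^sup>2)"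
    by (intro sum.cong)
      (auto simp: power2_norm_eq_inner inner_add_left inner_add_right inner_commute)
  also have "\<dots> = real n * (norm c)\<^sup>2 + 2 * (c \<bullet> (\<Sum>i=1..n. Z i)) + (\<Sum>i=1..n. (norm (Z i))\<^sup>2)"
    by (simp add: sum.distrib inner_sum_right sum_distrib_left)
  finally have S: "(\<Sum>i=1..n. (norm (c + Z i))\<^sup>2) =
      real n * (norm c)\<^sup>2 + (\<Sum>i=1..n. (norm (Z i))\<^sup>2)"
    unfolding Z by simp
  show ?case
    unfolding expectation_draws_Suc[OF n] upd Suc.IH sum.distrib S
    using n by (simp add: field_simps)
qed

text \<open>
  A fixed index is missed by all \<open>b\<close> draws with probability \<open>(1 - 1 / n) ^ b\<close>. The statement is
  linear in \<open>t\<close>, so that the induction may replace \<open>t\<close> by \<open>0\<close> once the index has been hit.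
\<close>

lemma expectation_draws_unhit:
  assumes n: "n \<ge> 1" and i: "i \<in> {1..n}"
  shows "measure_pmf.expectation (draws n b) (\<lambda>v. if i \<in> v ` {..<b} then 0 else t) =
    (1 - 1 / real n) ^ b * t"
proof (induction b arbitrary: t)
  case 0
  show ?case by simp
next
  case (Suc b)
  have upd: "(if i \<in> (v(b := l)) ` {..<Suc b} then 0 else t) =
      (if i \<in> v ` {..<b} then 0 else if l = i then 0 else t)" for v l
  proof -
    have "(v(b := l)) ` {..<Suc b} = insert l (v ` {..<b})"
      by (force simp: lessThan_Suc)
    then show ?thesis by auto
  qed
  have "(\<Sum>l=1..n. if l = i then 0 else t) = (\<Sum>l=1..n. t - (if l = i then t else 0))"
    by (intro sum.cong) auto
  also have "\<dots> = real n * t - t"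
    using i by (simp add: sum_subtractf)
  finally have S: "(\<Sum>l=1..n. if l = i then 0 else t) = real n * t - t" .
  show ?case
    unfolding expectation_draws_Suc[OF n] upd Suc.IH sum_distrib_left[symmetric] S
    using n by (simp add: field_simps)
qed

lemma unhit_probability_le:
  assumes "n \<ge> 1" "b \<le> n"
  shows "(1 - 1 / real n) ^ b \<le> 1 - real b / (2 * real n)"
proof -
  define x where "x = real b / real n"
  have x: "0 \<le> x" "x \<le> 1" using assms by (auto simp: x_def)
  have "(1 - 1 / real n) ^ b \<le> exp (- 1 / real n) ^ b"
    using assms exp_ge_add_one_self[of "- 1 / real n"] by (intro power_mono) auto
  also have "\<dots> = exp (- x)"
    by (simp add: x_def flip: exp_of_nat_mult)
  also have "\<dots> \<le> 1 / (1 + x)"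
    using x exp_ge_add_one_self[of x] by (simp add: exp_minus field_simps)
  also have "\<dots> \<le> 1 - x / 2"
  proof -
    have "0 \<le> x * (1 - x)" using x by simp
    then have "1 \<le> (1 - x / 2) * (1 + x)" by (simp add: algebra_simps)
    then show ?thesis using x by (subst pos_divide_le_eq) auto
  qed
  finally show ?thesis by (simp add: x_def)
qed

lemma expectation_mono_finite:
  fixes h h' :: "'a \<Rightarrow> real"
  assumes "finite (set_pmf p)" "\<And>w. w \<in> set_pmf p \<Longrightarrow> h w \<le> h' w"
  shows "measure_pmf.expectation p h \<le> measure_pmf.expectation p h'"
  using assms by (intro integral_mono_AE) (auto simp: AE_measure_pmf_iff integrable_measure_pmf_finite)

lemma expectation_cong_set_pmf:
  fixes h h' :: "'a \<Rightarrow> real"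
  assumes "\<And>w. w \<in> set_pmf p \<Longrightarrow> h w = h' w"
  shows "measure_pmf.expectation p h = measure_pmf.expectation p h'"
  using assms by (intro integral_cong_AE) (auto simp: AE_measure_pmf_iff)

section \<open>Gradients of averages and quadratic bounds\<close>

lemma has_gradient_gradient:
  assumes "differentiable_near d X h" "X \<subseteq> Rd d" "x \<in> X"
  shows "has_gradient d h x (gradient d h x)"
proof -
  obtain G where "has_gradient d h x G"
    using assms unfolding differentiable_near_def by blast
  then show ?thesis
    using gradient_eqI[of x d h G] assms by auto
qed

lemma has_gradient_avg:
  assumes "X \<subseteq> Rd d" "x \<in> X" "\<forall>i\<in>{1..n}. differentiable_near d X (f i)"
  shows "has_gradient d (avg n f) x ((1 / real n) *\<^sub>R (\<Sum>i=1..n. gradient d (f i) x))"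
proof -
  have g: "has_gradient d (f i) x (gradient d (f i) x)" if "i \<in> {1..n}" for i
    using has_gradient_gradient assms that by blast
  have "((\<lambda>x. (1 / real n) * (\<Sum>i=1..n. f i x)) has_derivative
      (\<lambda>v. (1 / real n) * (\<Sum>i=1..n. gradient d (f i) x \<bullet> v))) (at x within Rd d)"
    using g by (intro has_derivative_mult_right has_derivative_sum) (auto simp: has_gradient_def)
  moreover have "(1 / real n) *\<^sub>R (\<Sum>i=1..n. gradient d (f i) x) \<in> Rd d"
    using g subspace_Rd by (intro subspace_scale subspace_sum) (auto simp: has_gradient_def)
  ultimately show ?thesis
    by (simp add: has_gradient_def avg_def[abs_def] inner_sum_left)
qed

text \<open>
  The quadratic upper bound for a function with Lipschitz gradient. It is obtained by monotonicity
  along the segment from \<open>x\<close> to \<open>y\<close>: the whole line stays in \<open>Rd d\<close>, so that the relative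
  gradients give two-sided derivatives in \<open>t\<close>, the end points included.
\<close>

lemma smooth_descent:
  assumes X: "X \<subseteq> Rd d" "convex X"
    and diff: "\<And>x. x \<in> X \<Longrightarrow> has_gradient d h x (gradient d h x)"
    and smooth: "smooth_wrt d M X h"
    and x: "x \<in> X" and y: "y \<in> X"
  shows "h y \<le> h x + gradient d h x \<bullet> (y - x) + M / 2 * (norm (y - x))\<^sup>2"
proof -
  define p where "p t = x + t *\<^sub>R (y - x)" for t
  define G where "G = gradient d h"
  define \<psi> where "\<psi> t = h (p t) - t * (G x \<bullet> (y - x)) - M / 2 * (norm (y - x))\<^sup>2 * t\<^sup>2" for t
  have "\<psi> 1 \<le> \<psi> 0"
  proof (rule DERIV_nonpos_imp_nonincreasing[where f = \<psi>])
    fix t :: real assume t: "0 \<le> t" "t \<le> 1"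
    have "p t = (1 - t) *\<^sub>R x + t *\<^sub>R y" by (simp add: p_def algebra_simps)
    then have pX: "p t \<in> X" using X(2) x y t by (simp add: convexD)
    have img: "p ` UNIV \<subseteq> Rd d"
      using X(1) x y subspace_Rd unfolding p_def
      by (auto intro!: subspace_add subspace_scale subspace_diff)
    have "(h has_derivative (\<lambda>v. G (p t) \<bullet> v)) (at (p t) within p ` UNIV)"
      using diff[OF pX] img has_derivative_subset unfolding has_gradient_def G_def by blast
    moreover have "(p has_derivative (\<lambda>r. r *\<^sub>R (y - x))) (at t)"
      unfolding p_def[abs_def] by (auto intro!: derivative_eq_intros)
    ultimately have "((\<lambda>t. h (p t)) has_derivative (\<lambda>r. G (p t) \<bullet> (r *\<^sub>R (y - x)))) (at t)"
      using has_derivative_in_compose by blast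
    then have hp: "((\<lambda>t. h (p t)) has_real_derivative G (p t) \<bullet> (y - x)) (at t)"
      by (simp add: has_field_derivative_def mult.commute[of _ "G (p t) \<bullet> (y - x)"])
    have "(\<psi> has_real_derivative
        G (p t) \<bullet> (y - x) - G x \<bullet> (y - x) - M / 2 * (norm (y - x))\<^sup>2 * (2 * t)) (at t)"
      unfolding \<psi>_def[abs_def] by (auto intro!: derivative_eq_intros hp)
    moreover have "G (p t) \<bullet> (y - x) - G x \<bullet> (y - x) - M / 2 * (norm (y - x))\<^sup>2 * (2 * t) \<le> 0"
    proof -
      have "G (p t) \<bullet> (y - x) - G x \<bullet> (y - x) \<le> norm (G (p t) - G x) * norm (y - x)"
        using norm_cauchy_schwarz[of "G (p t) - G x" "y - x"] by (simp add: inner_diff_left)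
      also have "\<dots> \<le> (M * norm (p t - x)) * norm (y - x)"
        using smooth pX x by (intro mult_right_mono) (auto simp: smooth_wrt_def G_def)
      also have "\<dots> = M / 2 * (norm (y - x))\<^sup>2 * (2 * t)"
        using t by (simp add: p_def power2_eq_square)
      finally show ?thesis by simp
    qed
    ultimately show "\<exists>z. (\<psi> has_real_derivative z) (at t) \<and> z \<le> 0" by blast
  qed simp
  then show ?thesis by (simp add: \<psi>_def p_def G_def)
qed

lemma sum_norm_centered_le:
  fixes W :: "nat \<Rightarrow> 'a :: real_inner"
  assumes n: "n \<ge> 1" and m: "m = (1 / real n) *\<^sub>R (\<Sum>i=1..n. W i)"
  shows "(\<Sum>i=1..n. (norm (W i - m))\<^sup>2) \<le> (\<Sum>i=1..n. (norm (W i))\<^sup>2)"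
proof -
  have s: "(\<Sum>i=1..n. W i) = real n *\<^sub>R m" using n by (simp add: m)
  have "(\<Sum>i=1..n. (norm (W i - m))\<^sup>2) =
      (\<Sum>i=1..n. (norm (W i))\<^sup>2 - 2 * (W i \<bullet> m) + (norm m)\<^sup>2)"
    by (intro sum.cong)
      (auto simp: power2_norm_eq_inner inner_diff_left inner_diff_right inner_commute)
  also have "\<dots> = (\<Sum>i=1..n. (norm (W i))\<^sup>2) - 2 * ((\<Sum>i=1..n. W i) \<bullet> m) + real n * (norm m)\<^sup>2"
    by (simp add: sum.distrib sum_subtractf sum_distrib_left inner_sum_left)
  also have "\<dots> = (\<Sum>i=1..n. (norm (W i))\<^sup>2) - real n * (norm m)\<^sup>2"
    unfolding s by (simp add: power2_norm_eq_inner)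
  finally show ?thesis by simp
qed

lemma norm_add_sq_le_weighted:
  fixes u v :: "'a :: real_inner"
  assumes "\<beta> > 0"
  shows "(norm (u + v))\<^sup>2 \<le> (1 + \<beta>) * (norm u)\<^sup>2 + (1 + 1 / \<beta>) * (norm v)\<^sup>2"
proof -
  have "2 * (norm u * norm v) \<le> \<beta> * (norm u)\<^sup>2 + 1 / \<beta> * (norm v)\<^sup>2"
  proof -
    have "0 \<le> (\<beta> * norm u - norm v)\<^sup>2 / \<beta>" using assms by simp
    also have "\<dots> = \<beta> * (norm u)\<^sup>2 + 1 / \<beta> * (norm v)\<^sup>2 - 2 * (norm u * norm v)"
      using assms by (simp add: power2_eq_square field_simps)
    finally show ?thesis by simp
  qed
  moreover have "(norm (u + v))\<^sup>2 \<le> (norm u + norm v)\<^sup>2"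
    by (intro power_mono norm_triangle_ineq) simp
  ultimately show ?thesis by (simp add: power2_sum algebra_simps)
qed

section \<open>Analysis of a run\<close>

text \<open>
  One run of the algorithm with arbitrary momentum in \<open>[0, 1]\<close> and step sizes in \<open>[0, 1]\<close>. The special
  choices of both are added as hypotheses where they are needed. The variable \<open>w\<close> denotes an outcome,
  that is, the list of all batches.
\<close>

locale saga_sarah_fw =
  fixes d n :: nat and X f L Ls D x0 b lam \<eta> K x g y s
  assumes problem: "fw_problem d n X f L Ls D"
    and x0: "x0 \<in> X"
    and b: "1 \<le> b" "b \<le> n"
    and lam: "0 \<le> lam" "lam \<le> 1"
    and \<eta>: "\<And>k. k < K \<Longrightarrow> 0 \<le> \<eta> k \<and> \<eta> k \<le> 1"
    and run: "saga_sarah_fw_run d n X f x0 b lam \<eta> K x g y s"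
begin

abbreviation outcomes :: "(nat \<Rightarrow> nat \<Rightarrow> nat) set"
  where "outcomes \<equiv> set_pmf (batches n b K)"

abbreviation Ex :: "((nat \<Rightarrow> nat \<Rightarrow> nat) \<Rightarrow> real) \<Rightarrow> real"
  where "Ex \<equiv> measure_pmf.expectation (batches n b K)"

abbreviation G :: "nat \<Rightarrow> rseq \<Rightarrow> rseq"
  where "G i \<equiv> gradient d (f i)"

abbreviation Gavg :: "rseq \<Rightarrow> rseq"
  where "Gavg \<equiv> gradient d (avg n f)"

text \<open>
  The error of the gradient estimator.
\<close>

definition err :: "nat \<Rightarrow> (nat \<Rightarrow> nat \<Rightarrow> nat) \<Rightarrow> rseq"
  where "err k w = g k w - Gavg (x k w)"

text \<open>
  How far the stored gradients \<open>y\<^sub>i\<close> lag behind the current ones, in mean square.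
\<close>

definition staleness :: "nat \<Rightarrow> (nat \<Rightarrow> nat \<Rightarrow> nat) \<Rightarrow> real"
  where "staleness k w = (1 / real n) * (\<Sum>i=1..n. (norm (G i (x k w) - y k i w))\<^sup>2)"

lemma n: "n \<ge> 1" using b by simp

lemma X: "X \<subseteq> Rd d" "convex X" "D > 0" "\<And>u v. u \<in> X \<Longrightarrow> v \<in> X \<Longrightarrow> norm (u - v) \<le> D"
  using problem by (auto simp: fw_problem_def)

lemma L_pos: "L > 0"
  using problem by (auto simp: fw_problem_def smooth_wrt_def)

lemma Ls_pos: "i \<in> {1..n} \<Longrightarrow> Ls i > 0"
  using problem by (auto simp: fw_problem_def smooth_wrt_def)

lemma L_tilde_sq: "(L_tilde n Ls)\<^sup>2 = (1 / real n) * (\<Sum>i=1..n. (Ls i)\<^sup>2)"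
  by (simp add: L_tilde_def sum_nonneg)

lemma L_tilde_pos: "L_tilde n Ls > 0"
proof -
  have "(\<Sum>i=1..n. (Ls i)\<^sup>2) > 0"
  proof (intro sum_pos)
    show "0 < (Ls i)\<^sup>2" if "i \<in> {1..n}" for i
      using Ls_pos[OF that] by simp
  qed (use n in auto)
  then show ?thesis using n by (simp add: L_tilde_def)
qed

lemma has_gradient_objective:
  assumes "u \<in> X"
  shows "has_gradient d (avg n f) u (Gavg u)"
    and "Gavg u = (1 / real n) *\<^sub>R (\<Sum>i=1..n. G i u)"
proof -
  have *: "has_gradient d (avg n f) u ((1 / real n) *\<^sub>R (\<Sum>i=1..n. G i u))"
    using problem assms by (intro has_gradient_avg[of X]) (auto simp: fw_problem_def)
  show eq: "Gavg u = (1 / real n) *\<^sub>R (\<Sum>i=1..n. G i u)"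
    using gradient_eqI[OF _ *] X assms by auto
  show "has_gradient d (avg n f) u (Gavg u)"
    using * by (simp add: eq)
qed

lemma run_init:
  assumes "w \<in> outcomes"
  shows "x 0 w = x0" "g 0 w = Gavg x0" "\<And>i. i \<in> {1..n} \<Longrightarrow> y 0 i w = G i x0"
  using run assms by (auto simp: saga_sarah_fw_run_def)

lemma run_step:
  assumes "w \<in> outcomes" "k < K"
  shows "is_arg_min (\<lambda>v. g k w \<bullet> v) (\<lambda>v. v \<in> X) (s k w)"
    and "x (Suc k) w = x k w + \<eta> k *\<^sub>R (s k w - x k w)"
    and "g (Suc k) w = (1 / real b) *\<^sub>R (\<Sum>j<b. G (w k j) (x (Suc k) w) - G (w k j) (x k w))
          + (1 - lam) *\<^sub>R g k w
          + lam *\<^sub>R ((1 / real b) *\<^sub>R (\<Sum>j<b. G (w k j) (x k w) - y k (w k j) w)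
             + (1 / real n) *\<^sub>R (\<Sum>i=1..n. y k i w))"
    and "\<And>i. i \<in> {1..n} \<Longrightarrow> y (Suc k) i w =
          (if i \<in> w k ` {..<b} then G i (x (Suc k) w) else y k i w)"
  using run assms unfolding saga_sarah_fw_run_def by blast+

lemma s_in: "w \<in> outcomes \<Longrightarrow> k < K \<Longrightarrow> s k w \<in> X"
  using run_step(1) by (auto simp: is_arg_min_def)

lemma x_in:
  assumes "w \<in> outcomes" "k \<le> K"
  shows "x k w \<in> X"
  using assms(2)
proof (induction k)
  case 0
  show ?case using run_init[OF assms(1)] x0 by simp
next
  case (Suc k)
  have "x (Suc k) w = (1 - \<eta> k) *\<^sub>R x k w + \<eta> k *\<^sub>R s k w"
    using run_step(2)[OF assms(1), of k] Suc.prems by (simp add: algebra_simps)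
  then show ?case
    using Suc assms(1) \<eta>[of k] s_in[of w k] X(2) by (auto intro!: convexD)
qed

lemma lmo_causal:
  assumes "w \<in> outcomes" "w' \<in> outcomes" "k < K" "\<And>j. j < k \<Longrightarrow> w j = w' j"
  shows "s k w = s k w'"
proof -
  have "restrict w {..<k} = restrict w' {..<k}"
    using assms(4) by (intro restrict_ext) auto
  moreover obtain \<sigma> where "\<And>w. w \<in> outcomes \<Longrightarrow> s k w = \<sigma> (restrict w {..<k})"
    using run assms(3) unfolding saga_sarah_fw_run_def by blast
  ultimately show ?thesis using assms(1,2) by simp
qed

text \<open>
  The state before iteration \<open>k\<close> is a function of the batches drawn earlier.
\<close>

lemma iterates_causal:
  assumes "w \<in> outcomes" "w' \<in> outcomes" "k \<le> K" "\<And>j. j < k \<Longrightarrow> w j = w' j"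
  shows "x k w = x k w' \<and> g k w = g k w' \<and> (\<forall>i\<in>{1..n}. y k i w = y k i w')"
  using assms(3,4)
proof (induction k)
  case 0
  show ?case using run_init[OF assms(1)] run_init[OF assms(2)] by simp
next
  case (Suc k)
  have k: "k < K" and IH: "x k w = x k w'" "g k w = g k w'" "\<And>i. i \<in> {1..n} \<Longrightarrow> y k i w = y k i w'"
    using Suc by auto
  have wk: "w k = w' k" and s: "s k w = s k w'"
    using Suc.prems lmo_causal[OF assms(1,2) k] by auto
  have x': "x (Suc k) w = x (Suc k) w'"
    by (simp add: run_step(2)[OF assms(1) k] run_step(2)[OF assms(2) k] IH s)
  have "w' k j \<in> {1..n}" if "j < b" for j
    using draws_range[OF n batches_range[OF k assms(2)] that] .
  then have "y k (w' k j) w = y k (w' k j) w'" if "j < b" for j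
    using IH(3) that by blast
  then have "g (Suc k) w = g (Suc k) w'"
    using IH(3) by (simp add: run_step(3)[OF assms(1) k] run_step(3)[OF assms(2) k] IH(1,2) wk x')
  moreover have "y (Suc k) i w = y (Suc k) i w'" if "i \<in> {1..n}" for i
    using that by (simp add: run_step(4)[OF assms(1) k] run_step(4)[OF assms(2) k] IH(3) wk x')
  ultimately show ?case using x' by blast
qed

text \<open>
  Hence redrawing the \<open>k\<close>-th batch affects neither the state before iteration \<open>k\<close> nor the next
  iterate, which depends on that state and on the answer of the minimization oracle only.
\<close>

lemma resampled_state:
  assumes "w \<in> outcomes" "k < K" "v \<in> set_pmf (draws n b)"
  shows "w(k := v) \<in> outcomes" "x k (w(k := v)) = x k w" "g k (w(k := v)) = g k w"
    "\<And>i. i \<in> {1..n} \<Longrightarrow> y k i (w(k := v)) = y k i w"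
    "x (Suc k) (w(k := v)) = x (Suc k) w"
proof -
  show in': "w(k := v) \<in> outcomes" using batches_update assms by blast
  have *: "x k (w(k := v)) = x k w \<and> g k (w(k := v)) = g k w \<and>
      (\<forall>i\<in>{1..n}. y k i (w(k := v)) = y k i w)"
    using assms by (intro iterates_causal[OF in']) auto
  then show "x k (w(k := v)) = x k w" "g k (w(k := v)) = g k w"
    "\<And>i. i \<in> {1..n} \<Longrightarrow> y k i (w(k := v)) = y k i w" by auto
  have "s k (w(k := v)) = s k w"
    using assms by (intro lmo_causal[OF in']) auto
  then show "x (Suc k) (w(k := v)) = x (Suc k) w"
    using * run_step(2)[OF in' assms(2)] run_step(2)[OF assms(1,2)] by simp
qed

lemma expectation_step_le:
  assumes "k < K"
    and "\<And>w. w \<in> outcomes \<Longrightarrow>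
      measure_pmf.expectation (draws n b) (\<lambda>v. h (w(k := v))) \<le> \<Phi> w"
  shows "Ex h \<le> Ex \<Phi>"
  unfolding expectation_resample[OF n assms(1), of b h]
  using n assms(2) by (intro expectation_mono_finite) auto

lemma step_length:
  assumes "w \<in> outcomes" "k < K"
  shows "norm (x (Suc k) w - x k w) \<le> \<eta> k * D"
  using run_step(2)[OF assms] \<eta>[OF assms(2)] X(4)[of "s k w" "x k w"] s_in[OF assms]
    x_in[of w k] assms by (auto intro: mult_left_mono)

lemma gradient_change_mean_square:
  assumes "w \<in> outcomes" "k < K"
  shows "(1 / real n) * (\<Sum>i=1..n. (norm (G i (x (Suc k) w) - G i (x k w)))\<^sup>2)
    \<le> (L_tilde n Ls)\<^sup>2 * D\<^sup>2 * (\<eta> k)\<^sup>2"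
proof -
  have "(norm (G i (x (Suc k) w) - G i (x k w)))\<^sup>2 \<le> (Ls i)\<^sup>2 * (\<eta> k * D)\<^sup>2" if "i \<in> {1..n}" for i
  proof -
    have "norm (G i (x (Suc k) w) - G i (x k w)) \<le> Ls i * norm (x (Suc k) w - x k w)"
      using problem that x_in[of w "Suc k"] x_in[of w k] assms
      by (auto simp: fw_problem_def smooth_wrt_def)
    also have "\<dots> \<le> Ls i * (\<eta> k * D)"
      using step_length[OF assms] Ls_pos[OF that] by (intro mult_left_mono) auto
    finally show ?thesis
      by (metis norm_ge_zero power_mono power_mult_distrib)
  qed
  then have "(\<Sum>i=1..n. (norm (G i (x (Suc k) w) - G i (x k w)))\<^sup>2)
      \<le> (\<Sum>i=1..n. (Ls i)\<^sup>2) * (\<eta> k * D)\<^sup>2"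
    unfolding sum_distrib_right by (rule sum_mono)
  then have "(1 / real n) * (\<Sum>i=1..n. (norm (G i (x (Suc k) w) - G i (x k w)))\<^sup>2)
      \<le> (1 / real n) * ((\<Sum>i=1..n. (Ls i)\<^sup>2) * (\<eta> k * D)\<^sup>2)"
    by (intro mult_left_mono) auto
  also have "\<dots> = (L_tilde n Ls)\<^sup>2 * D\<^sup>2 * (\<eta> k)\<^sup>2"
    by (simp add: L_tilde_sq power_mult_distrib)
  finally show ?thesis .
qed

text \<open>
  Given the past, the new error is \<open>(1 - lam)\<close> times the old one plus an average of \<open>b\<close> independent
  centred vectors \<open>W\<^sub>i - m\<close>. The variance of the average is \<open>1 / b\<close> times that of a single vector,
  which combines the gradient change along the step and the staleness.
\<close>

lemma err_resampled:
  assumes w: "w \<in> outcomes" and k: "k < K"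
  shows "measure_pmf.expectation (draws n b) (\<lambda>v. (norm (err (Suc k) (w(k := v))))\<^sup>2)
    \<le> (1 - lam) * (norm (err k w))\<^sup>2 + 2 * lam\<^sup>2 / real b * staleness k w
      + 2 / real b * ((L_tilde n Ls)\<^sup>2 * D\<^sup>2 * (\<eta> k)\<^sup>2)"
proof -
  define x1 where "x1 = x (Suc k) w"
  define xk where "xk = x k w"
  define ybar where "ybar = (1 / real n) *\<^sub>R (\<Sum>i=1..n. y k i w)"
  \<comment> \<open>One sampled index contributes \<open>W i\<close>; \<open>m\<close> is its mean under uniform sampling.\<close>
  define W where "W i = (G i x1 - G i xk) + lam *\<^sub>R (G i xk - y k i w)" for i
  define m where "m = (1 / real n) *\<^sub>R (\<Sum>i=1..n. W i)"
  define Z where "Z i = (1 / real b) *\<^sub>R (W i - m)" for i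
  have xX: "x1 \<in> X" "xk \<in> X" using x_in w k by (auto simp: x1_def xk_def)
  have m: "m = (Gavg x1 - Gavg xk) + lam *\<^sub>R (Gavg xk - ybar)"
    by (simp add: m_def W_def has_gradient_objective[OF xX(1)] has_gradient_objective[OF xX(2)]
        ybar_def sum.distrib sum_subtractf scaleR_sum_right[symmetric] algebra_simps)
  have sumZ: "(\<Sum>i=1..n. Z i) = 0"
    using n by (simp add: Z_def m_def sum_subtractf scaleR_sum_right[symmetric] scaleR_right_diff_distrib sum_constant_scaleR)
  have err: "err (Suc k) (w(k := v)) = (1 - lam) *\<^sub>R err k w + (\<Sum>j<b. Z (v j))"
    if v: "v \<in> set_pmf (draws n b)" for v
  proof -
    note st = resampled_state[OF w k v]
    have yv: "y k (v j) (w(k := v)) = y k (v j) w" if "j < b" for j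
      using st(4) draws_range[OF n v that] .
    have sums: "(\<Sum>j<b. Z (v j)) = (1 / real b) *\<^sub>R (\<Sum>j<b. G (v j) x1 - G (v j) xk)
        + lam *\<^sub>R ((1 / real b) *\<^sub>R (\<Sum>j<b. G (v j) xk - y k (v j) w)) - m"
    proof -
      have "(\<Sum>j<b. Z (v j)) = (1 / real b) *\<^sub>R (\<Sum>j<b. W (v j) - m)"
        by (simp add: Z_def scaleR_sum_right)
      also have "(\<Sum>j<b. W (v j) - m) = (\<Sum>j<b. G (v j) x1 - G (v j) xk)
          + lam *\<^sub>R (\<Sum>j<b. G (v j) xk - y k (v j) w) - real b *\<^sub>R m"
        by (simp add: W_def sum.distrib sum_subtractf scaleR_sum_right[symmetric] sum_constant_scaleR)
      finally show ?thesis
        using b by (simp add: scaleR_add_right scaleR_diff_right scaleR_left_commute)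
    qed
    have "g (Suc k) (w(k := v)) = (1 / real b) *\<^sub>R (\<Sum>j<b. G (v j) x1 - G (v j) xk)
        + (1 - lam) *\<^sub>R g k w
        + lam *\<^sub>R ((1 / real b) *\<^sub>R (\<Sum>j<b. G (v j) xk - y k (v j) w) + ybar)"
      using run_step(3)[OF st(1) k] st yv by (simp add: x1_def xk_def ybar_def)
    then show ?thesis
      unfolding err_def sums m st(5) x1_def[symmetric] xk_def[symmetric]
      by (simp add: algebra_simps)
  qed
  have "measure_pmf.expectation (draws n b) (\<lambda>v. (norm (err (Suc k) (w(k := v))))\<^sup>2)
      = measure_pmf.expectation (draws n b)
          (\<lambda>v. (norm ((1 - lam) *\<^sub>R err k w + (\<Sum>j<b. Z (v j))))\<^sup>2)"
    by (intro expectation_cong_set_pmf) (simp add: err)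
  also have "\<dots> = (norm ((1 - lam) *\<^sub>R err k w))\<^sup>2
      + real b * ((1 / real n) * (\<Sum>i=1..n. (norm (Z i))\<^sup>2))"
    by (rule expectation_draws_norm_sum[OF n sumZ])
  finally have expand: "measure_pmf.expectation (draws n b) (\<lambda>v. (norm (err (Suc k) (w(k := v))))\<^sup>2)
      = (norm ((1 - lam) *\<^sub>R err k w))\<^sup>2
        + real b * ((1 / real n) * (\<Sum>i=1..n. (norm (Z i))\<^sup>2))" .
  have "real b * ((1 / real n) * (\<Sum>i=1..n. (norm (Z i))\<^sup>2))
      = 1 / (real b * real n) * (\<Sum>i=1..n. (norm (W i - m))\<^sup>2)"
    using b by (simp add: Z_def power_divide sum_divide_distrib[symmetric] power2_eq_square[of "real b"])
  also have "\<dots> \<le> 1 / (real b * real n) * (\<Sum>i=1..n. (norm (W i))\<^sup>2)"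
    by (intro mult_left_mono sum_norm_centered_le[OF n m_def]) auto
  also have "\<dots> \<le> 1 / (real b * real n) * (\<Sum>i=1..n. 2 * (norm (G i x1 - G i xk))\<^sup>2
      + 2 * (lam\<^sup>2 * (norm (G i xk - y k i w))\<^sup>2))"
  proof (intro mult_left_mono sum_mono)
    fix i
    show "(norm (W i))\<^sup>2 \<le> 2 * (norm (G i x1 - G i xk))\<^sup>2 + 2 * (lam\<^sup>2 * (norm (G i xk - y k i w))\<^sup>2)"
      using norm_add_sq_le_weighted[of 1 "G i x1 - G i xk" "lam *\<^sub>R (G i xk - y k i w)"]
      by (simp add: W_def power_mult_distrib)
  qed auto
  also have "\<dots> = 2 / real b * ((1 / real n) * (\<Sum>i=1..n. (norm (G i x1 - G i xk))\<^sup>2))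
      + 2 * lam\<^sup>2 / real b * staleness k w"
  proof -
    have "1 / (real b * real n) * (2 * A + 2 * (lam\<^sup>2 * S)) =
        2 / real b * (1 / real n * A) + 2 * lam\<^sup>2 / real b * (1 / real n * S)" for A S
      using n b by (simp add: field_simps)
    then show ?thesis
      by (simp only: staleness_def xk_def sum.distrib sum_distrib_left[symmetric])
  qed
  also have "\<dots> \<le> 2 / real b * ((L_tilde n Ls)\<^sup>2 * D\<^sup>2 * (\<eta> k)\<^sup>2) + 2 * lam\<^sup>2 / real b * staleness k w"
    using gradient_change_mean_square[OF w k]
    by (intro add_right_mono mult_left_mono) (auto simp: x1_def xk_def)
  finally have noise: "real b * ((1 / real n) * (\<Sum>i=1..n. (norm (Z i))\<^sup>2))
      \<le> 2 / real b * ((L_tilde n Ls)\<^sup>2 * D\<^sup>2 * (\<eta> k)\<^sup>2) + 2 * lam\<^sup>2 / real b * staleness k w" .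
  have "(1 - lam)\<^sup>2 \<le> 1 - lam"
    using lam mult_right_mono[of "1 - lam" 1 "1 - lam"] by (simp add: power2_eq_square)
  then have "(norm ((1 - lam) *\<^sub>R err k w))\<^sup>2 \<le> (1 - lam) * (norm (err k w))\<^sup>2"
    by (simp add: power_mult_distrib mult_right_mono)
  with expand noise show ?thesis by linarith
qed

text \<open>
  An entry survives with probability at most \<open>1 - q\<close>, where \<open>q = b / (2 n)\<close>. For a surviving entry the
  squared triangle inequality with weight \<open>q / 2\<close> costs only half of this contraction.
\<close>

lemma staleness_resampled:
  assumes w: "w \<in> outcomes" and k: "k < K"
  shows "measure_pmf.expectation (draws n b) (\<lambda>v. staleness (Suc k) (w(k := v)))
    \<le> (1 - real b / (4 * real n)) * staleness k w
      + 4 * real n / real b * ((L_tilde n Ls)\<^sup>2 * D\<^sup>2 * (\<eta> k)\<^sup>2)"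
proof -
  define q where "q = real b / (2 * real n)"
  have q: "0 < q" "q \<le> 1" using b by (auto simp: q_def)
  define x1 where "x1 = x (Suc k) w"
  define xk where "xk = x k w"
  define t where "t i = (norm (G i x1 - y k i w))\<^sup>2" for i
  have st: "staleness (Suc k) (w(k := v)) =
      (1 / real n) * (\<Sum>i=1..n. if i \<in> v ` {..<b} then 0 else t i)"
    if v: "v \<in> set_pmf (draws n b)" for v
  proof -
    note st = resampled_state[OF w k v]
    have "(norm (G i (x (Suc k) (w(k := v))) - y (Suc k) i (w(k := v))))\<^sup>2 =
        (if i \<in> v ` {..<b} then 0 else t i)" if "i \<in> {1..n}" for i
      using run_step(4)[OF st(1) k that] st(4)[OF that] st(5) by (simp add: t_def x1_def)
    then show ?thesis by (simp add: staleness_def)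
  qed
  have t: "(1 - 1 / real n) ^ b * t i \<le> (1 - q / 2) * (norm (G i xk - y k i w))\<^sup>2
      + 2 / q * (norm (G i x1 - G i xk))\<^sup>2" for i
  proof -
    define A where "A = (norm (G i xk - y k i w))\<^sup>2"
    define B where "B = (norm (G i x1 - G i xk))\<^sup>2"
    have AB: "A \<ge> 0" "B \<ge> 0" by (auto simp: A_def B_def)
    have "t i \<le> (1 + q / 2) * A + (1 + 2 / q) * B"
      using norm_add_sq_le_weighted[of "q / 2" "G i xk - y k i w" "G i x1 - G i xk"] q
      by (simp add: t_def A_def B_def)
    moreover have "(1 - 1 / real n) ^ b \<le> 1 - q"
      using unhit_probability_le[OF n b(2)] by (simp add: q_def)
    ultimately have "(1 - 1 / real n) ^ b * t i \<le> (1 - q) * ((1 + q / 2) * A + (1 + 2 / q) * B)"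
      using q by (intro mult_mono) (auto simp: t_def)
    also have "\<dots> = (1 - q / 2 - q\<^sup>2 / 2) * A + (2 / q - 1 - q) * B"
      using q by (simp add: field_simps power2_eq_square)
    also have "\<dots> \<le> (1 - q / 2) * A + 2 / q * B"
      using q AB by (intro add_mono mult_right_mono) auto
    finally show ?thesis by (simp add: A_def B_def)
  qed
  have "measure_pmf.expectation (draws n b) (\<lambda>v. staleness (Suc k) (w(k := v)))
      = measure_pmf.expectation (draws n b)
          (\<lambda>v. (1 / real n) * (\<Sum>i=1..n. if i \<in> v ` {..<b} then 0 else t i))"
    by (intro expectation_cong_set_pmf) (simp add: st)
  also have "\<dots> = (1 / real n) * (\<Sum>i=1..n.
      measure_pmf.expectation (draws n b) (\<lambda>v. if i \<in> v ` {..<b} then 0 else t i))"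
    using n by (subst integral_mult_right_zero, subst Bochner_Integration.integral_sum) auto
  also have "\<dots> = (1 / real n) * (\<Sum>i=1..n. (1 - 1 / real n) ^ b * t i)"
    using n by (simp add: expectation_draws_unhit)
  also have "\<dots> \<le> (1 / real n) * (\<Sum>i=1..n. (1 - q / 2) * (norm (G i xk - y k i w))\<^sup>2
      + 2 / q * (norm (G i x1 - G i xk))\<^sup>2)"
    by (intro mult_left_mono sum_mono t) auto
  also have "\<dots> = (1 - q / 2) * staleness k w
      + 2 / q * ((1 / real n) * (\<Sum>i=1..n. (norm (G i x1 - G i xk))\<^sup>2))"
    by (simp only: staleness_def xk_def sum.distrib sum_distrib_left[symmetric] distrib_left
        mult.left_commute)
  also have "\<dots> \<le> (1 - q / 2) * staleness k w + 2 / q * ((L_tilde n Ls)\<^sup>2 * D\<^sup>2 * (\<eta> k)\<^sup>2)"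
    using gradient_change_mean_square[OF w k] q
    by (intro add_left_mono mult_left_mono) (auto simp: x1_def xk_def)
  finally show ?thesis by (simp add: q_def)
qed

text \<open>
  The Lyapunov function for the estimation error. The weight \<open>4 / n\<close> is chosen such that half of the
  decrease of the staleness pays for its contribution to the error.
\<close>

definition V :: "nat \<Rightarrow> real"
  where "V k = Ex (\<lambda>w. (norm (err k w))\<^sup>2) + 4 / real n * Ex (staleness k)"

lemma V_0: "V 0 = 0"
proof -
  have "Ex (\<lambda>w. (norm (err 0 w))\<^sup>2) = Ex (\<lambda>_. 0)"
    by (intro expectation_cong_set_pmf) (simp add: err_def run_init)
  moreover have "Ex (staleness 0) = Ex (\<lambda>_. 0)"
    by (intro expectation_cong_set_pmf) (simp add: staleness_def run_init)
  ultimately show ?thesis by (simp add: V_def)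
qed

lemma V_Suc_le:
  assumes lam_eq: "lam = real b / (2 * real n)" and k: "k < K"
  shows "V (Suc k) \<le> (1 - 1 / (8 * real n / real b)) * V k
    + 18 * (L_tilde n Ls)\<^sup>2 * D\<^sup>2 / real b * (\<eta> k)\<^sup>2"
proof -
  define c where "c = (L_tilde n Ls)\<^sup>2 * D\<^sup>2 * (\<eta> k)\<^sup>2"
  define A where "A = Ex (\<lambda>w. (norm (err k w))\<^sup>2)"
  define S where "S = Ex (staleness k)"
  have A: "A \<ge> 0" unfolding A_def by (rule integral_nonneg_AE) simp
  note [simp] = integrable_batches[OF n]
  have "Ex (\<lambda>w. (norm (err (Suc k) w))\<^sup>2) \<le>
      Ex (\<lambda>w. (1 - lam) * (norm (err k w))\<^sup>2 + 2 * lam\<^sup>2 / real b * staleness k w + 2 / real b * c)"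
    unfolding c_def by (rule expectation_step_le[OF k]) (rule err_resampled[OF _ k])
  also have "\<dots> = (1 - lam) * A + 2 * lam\<^sup>2 / real b * S + 2 / real b * c"
    by (simp add: A_def S_def)
  finally have e: "Ex (\<lambda>w. (norm (err (Suc k) w))\<^sup>2) \<le> \<dots>" .
  have "Ex (staleness (Suc k)) \<le>
      Ex (\<lambda>w. (1 - real b / (4 * real n)) * staleness k w + 4 * real n / real b * c)"
    unfolding c_def by (rule expectation_step_le[OF k]) (rule staleness_resampled[OF _ k])
  also have "\<dots> = (1 - real b / (4 * real n)) * S + 4 * real n / real b * c"
    by (simp add: S_def)
  finally have "4 / real n * Ex (staleness (Suc k)) \<le>
      4 / real n * ((1 - real b / (4 * real n)) * S + 4 * real n / real b * c)"
    by (intro mult_left_mono) auto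
  with e have "V (Suc k) \<le> (1 - lam) * A + 2 * lam\<^sup>2 / real b * S + 2 / real b * c
      + 4 / real n * ((1 - real b / (4 * real n)) * S + 4 * real n / real b * c)"
    unfolding V_def by linarith
  also have "\<dots> = (1 - real b / (2 * real n)) * A
      + (1 - real b / (8 * real n)) * (4 / real n * S) + 18 / real b * c"
    using n b by (simp add: lam_eq field_simps power2_eq_square)
  also have "\<dots> \<le> (1 - real b / (8 * real n)) * A
      + (1 - real b / (8 * real n)) * (4 / real n * S) + 18 / real b * c"
    using n A by (intro add_right_mono mult_right_mono) (auto simp: frac_le)
  finally show ?thesis
    by (simp add: V_def A_def S_def c_def algebra_simps)
qed

text \<open>
  The mean square error is of order \<open>(L_tilde n Ls * sqrt (real n) / b * D * \<eta>\<^sub>k)\<^sup>2\<close>: it tracks the current step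
  size.
\<close>

lemma mean_square_err_le:
  assumes lam_eq: "lam = real b / (2 * real n)" and k: "k < K"
    and \<eta>_eq: "\<And>k. k < K \<Longrightarrow> \<eta> k = 2 / (8 * real n / real b + real (k - h))"
  shows "Ex (\<lambda>w. (norm (err k w))\<^sup>2) \<le> (63 * L_tilde n Ls * sqrt (real n) / real b * D * \<eta> k)\<^sup>2"
proof -
  define a where "a = 8 * real n / real b"
  define c where "c = 18 * (L_tilde n Ls)\<^sup>2 * D\<^sup>2 / real b"
  have a: "a \<ge> 8" and c: "c \<ge> 0" using b by (auto simp: a_def c_def field_simps)
  have "Ex (staleness k) \<ge> 0"
    unfolding staleness_def
    by (intro integral_nonneg_AE AE_I2 mult_nonneg_nonneg sum_nonneg) auto
  then have "Ex (\<lambda>w. (norm (err k w))\<^sup>2) \<le> V k" by (simp add: V_def)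
  also have "\<dots> \<le> 3 * a * c * (6 / (3 * a + real (k - h)))\<^sup>2"
    using a c k V_Suc_le[OF lam_eq]
    by (intro error_recursion_bound[where K = K and \<eta> = \<eta>])
      (auto simp: V_0 \<eta>_eq a_def[symmetric] c_def[symmetric])
  also have "\<dots> \<le> 3 * a * c * (3 * \<eta> k)\<^sup>2"
  proof -
    have "6 / (3 * a + real (k - h)) \<le> 3 * (2 / (a + real (k - h)))"
      using a by (simp add: frac_le)
    then show ?thesis
      using a c k by (intro mult_left_mono power_mono) (auto simp: \<eta>_eq a_def[symmetric])
  qed
  also have "\<dots> = 3888 * (L_tilde n Ls * D * \<eta> k / real b)\<^sup>2 * real n"
    by (simp add: a_def c_def power_mult_distrib power_divide power2_eq_square[of "real b"])
  also have "\<dots> \<le> 3969 * (L_tilde n Ls * D * \<eta> k / real b)\<^sup>2 * real n"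
    by (intro mult_right_mono) auto
  also have "\<dots> = (63 * L_tilde n Ls * sqrt (real n) / real b * D * \<eta> k)\<^sup>2"
    by (simp add: power_mult_distrib power_divide)
  finally show ?thesis .
qed

text \<open>
  The usual Frank-Wolfe decrease, with the estimator error entering through
  \<open>err k w \<bullet> (u - s k w) \<le> D * norm (err k w)\<close>.
\<close>

lemma frank_wolfe_progress:
  assumes w: "w \<in> outcomes" and k: "k < K" and u: "u \<in> X"
  shows "avg n f (x (Suc k) w) - avg n f u \<le> (1 - \<eta> k) * (avg n f (x k w) - avg n f u)
    + \<eta> k * (D * norm (err k w)) + L / 2 * D\<^sup>2 * (\<eta> k)\<^sup>2"
proof -
  define F where "F = avg n f"
  define xk where "xk = x k w"
  define sk where "sk = s k w"
  have xX: "xk \<in> X" "x (Suc k) w \<in> X" and sX: "sk \<in> X"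
    using x_in s_in w k by (auto simp: xk_def sk_def)
  have e: "0 \<le> \<eta> k" "\<eta> k \<le> 1" using \<eta> k by auto
  have x1: "x (Suc k) w - xk = \<eta> k *\<^sub>R (sk - xk)"
    using run_step(2)[OF w k] by (simp add: xk_def sk_def)
  have "F (x (Suc k) w) \<le> F xk + Gavg xk \<bullet> (x (Suc k) w - xk)
      + L / 2 * (norm (x (Suc k) w - xk))\<^sup>2"
    unfolding F_def using problem xX has_gradient_objective(1)
    by (intro smooth_descent[OF X(1,2)]) (auto simp: fw_problem_def)
  also have "\<dots> = F xk + \<eta> k * (Gavg xk \<bullet> (sk - xk)) + L / 2 * (norm (sk - xk))\<^sup>2 * (\<eta> k)\<^sup>2"
    by (simp add: x1 power_mult_distrib)
  also have "\<dots> \<le> F xk + \<eta> k * (F u - F xk + D * norm (err k w)) + L / 2 * D\<^sup>2 * (\<eta> k)\<^sup>2"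
  proof (intro add_mono mult_left_mono mult_right_mono power_mono order_refl)
    have "g k w \<bullet> sk \<le> g k w \<bullet> u"
      using run_step(1)[OF w k] u by (auto simp: is_arg_min_def sk_def not_less)
    then have "Gavg xk \<bullet> (sk - xk) \<le> Gavg xk \<bullet> (u - xk) + err k w \<bullet> (u - sk)"
      by (simp add: err_def xk_def inner_diff_left inner_diff_right)
    also have "Gavg xk \<bullet> (u - xk) \<le> F u - F xk"
    proof -
      have "gradient_convex d X F" using problem by (simp add: fw_problem_def F_def)
      then have "F xk + Gavg xk \<bullet> (u - xk) \<le> F u"
        using u xX unfolding gradient_convex_def F_def by blast
      then show ?thesis by simp
    qed
    also have "err k w \<bullet> (u - sk) \<le> norm (err k w) * norm (u - sk)"
      by (rule norm_cauchy_schwarz)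
    also have "\<dots> \<le> norm (err k w) * D"
      using X(4) u sX by (intro mult_left_mono) auto
    finally show "Gavg xk \<bullet> (sk - xk) \<le> F u - F xk + D * norm (err k w)"
      by (simp add: mult.commute)
  qed (use e L_pos X(4) sX xX in auto)
  finally show ?thesis by (simp add: F_def xk_def algebra_simps)
qed

theorem expected_suboptimality_le:
  assumes lam_eq: "lam = real b / (2 * real n)" and K: "K > 0"
    and \<eta>_eq: "\<And>k. k < K \<Longrightarrow> \<eta> k = 2 / (8 * real n / real b + real (k - (K + 1) div 2))"
    and u: "is_arg_min (avg n f) (\<lambda>x. x \<in> X) u"
  shows "Ex (\<lambda>w. avg n f (x K w) - avg n f u)
    \<le> 2 * exp (- real K / (8 * real n / real b)) * (avg n f x0 - avg n f u)
      + 16 * (L / 2 + 63 * L_tilde n Ls * sqrt (real n) / real b) * D\<^sup>2 / real K"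
proof -
  define a where "a = 8 * real n / real b"
  define B where "B = 63 * L_tilde n Ls * sqrt (real n) / real b"
  define F where "F k = Ex (\<lambda>w. avg n f (x k w) - avg n f u)" for k
  have a: "a \<ge> 8" using b by (auto simp: a_def field_simps)
  have B: "B > 0" using L_tilde_pos n b by (simp add: B_def)
  note [simp] = integrable_batches[OF n]
  have uX: "u \<in> X" and umin: "\<And>v. v \<in> X \<Longrightarrow> avg n f u \<le> avg n f v"
    using u by (auto simp: is_arg_min_def not_less)
  have "F 0 = Ex (\<lambda>_. avg n f x0 - avg n f u)"
    unfolding F_def by (intro expectation_cong_set_pmf) (simp add: run_init)
  then have F0: "F 0 = avg n f x0 - avg n f u" by simp
  have rec: "F (Suc k) \<le> (1 - \<eta> k) * F k + ((L / 2 + B) * D\<^sup>2) * (\<eta> k)\<^sup>2" if k: "k < K" for k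
  proof -
    have \<eta>k: "\<eta> k > 0" using \<eta>_eq[OF k] a by (simp add: a_def[symmetric])
    define m where "m = B * \<eta> k"
    have m: "m > 0" using B \<eta>k by (simp add: m_def)
    \<comment> \<open>\<open>m * D\<close> is the bound on the root mean square of the error, so that Young's
      inequality with this weight loses nothing.\<close>
    have young: "D * r \<le> m * D\<^sup>2 / 2 + r\<^sup>2 / (2 * m)" for r
    proof -
      have "0 \<le> (m * D - r)\<^sup>2 / (2 * m)" using m by simp
      also have "\<dots> = m * D\<^sup>2 / 2 + r\<^sup>2 / (2 * m) - D * r"
        using m by (simp add: field_simps power2_eq_square)
      finally show ?thesis by simp
    qed
    have "Ex (\<lambda>w. (norm (err k w))\<^sup>2) \<le> (m * D)\<^sup>2"
      using mean_square_err_le[OF lam_eq k \<eta>_eq] by (simp add: m_def B_def mult_ac)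
    then have "Ex (\<lambda>w. (norm (err k w))\<^sup>2) / (2 * m) \<le> (m * D)\<^sup>2 / (2 * m)"
      using m by (intro divide_right_mono) auto
    also have "\<dots> = m * D\<^sup>2 / 2"
      using m by (simp add: power2_eq_square)
    finally have E: "Ex (\<lambda>w. (norm (err k w))\<^sup>2) / (2 * m) \<le> m * D\<^sup>2 / 2" .
    have "F (Suc k) \<le> Ex (\<lambda>w. (1 - \<eta> k) * (avg n f (x k w) - avg n f u)
        + \<eta> k * (m * D\<^sup>2 / 2 + (norm (err k w))\<^sup>2 / (2 * m)) + L / 2 * D\<^sup>2 * (\<eta> k)\<^sup>2)"
      unfolding F_def
    proof (intro expectation_mono_finite finite_set_batches n)
      fix w assume "w \<in> outcomes"
      from frank_wolfe_progress[OF this k uX]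
        mult_left_mono[OF young[of "norm (err k w)"] less_imp_le[OF \<eta>k]]
      show "avg n f (x (Suc k) w) - avg n f u \<le> (1 - \<eta> k) * (avg n f (x k w) - avg n f u)
        + \<eta> k * (m * D\<^sup>2 / 2 + (norm (err k w))\<^sup>2 / (2 * m)) + L / 2 * D\<^sup>2 * (\<eta> k)\<^sup>2"
        by linarith
    qed
    also have "\<dots> = (1 - \<eta> k) * F k
        + \<eta> k * (m * D\<^sup>2 / 2 + Ex (\<lambda>w. (norm (err k w))\<^sup>2) / (2 * m)) + L / 2 * D\<^sup>2 * (\<eta> k)\<^sup>2"
      by (simp add: F_def)
    also have "\<dots> \<le> (1 - \<eta> k) * F k + \<eta> k * (m * D\<^sup>2 / 2 + m * D\<^sup>2 / 2) + L / 2 * D\<^sup>2 * (\<eta> k)\<^sup>2"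
      using E \<eta>k by (intro add_right_mono add_left_mono mult_left_mono) auto
    also have "\<dots> = (1 - \<eta> k) * F k + ((L / 2 + B) * D\<^sup>2) * (\<eta> k)\<^sup>2"
      by (simp add: m_def algebra_simps power2_eq_square)
    finally show ?thesis .
  qed
  have "F K \<le> 2 * exp (- real K / a) * F 0 + 16 * ((L / 2 + B) * D\<^sup>2) / real K"
    using L_pos B umin[OF x0] a K \<eta>_eq
    by (intro suboptimality_recursion_bound[where F = F and \<eta> = \<eta>] rec) (auto simp: F0 a_def[symmetric])
  then show ?thesis
    unfolding F0 unfolding F_def a_def B_def by (simp only: mult.assoc)
qed

end

section \<open>Complexity\<close>

theorem corollary4p6:
  shows "\<exists>C>0. \<forall>(d::nat) (n::nat) (X::rseq set) (f::nat \<Rightarrow> rseq \<Rightarrow> real) (L::real)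
      (Ls::nat \<Rightarrow> real) (D::real) (xstar::rseq) (x0::rseq) (b::nat).
    fw_problem d n X f L Ls D \<longrightarrow>
    is_arg_min (avg n f) (\<lambda>x. x \<in> X) xstar \<longrightarrow>
    x0 \<in> X \<longrightarrow> 1 \<le> b \<longrightarrow> b \<le> n \<longrightarrow>
    (\<exists>\<epsilon>0>0. \<forall>\<epsilon>. 0 < \<epsilon> \<and> \<epsilon> \<le> \<epsilon>0 \<longrightarrow>
      (\<exists>K.
        (\<forall>x g y s.
          saga_sarah_fw_run d n X f x0 b (real b / (2 * real n)) (step_size n b K) K x g y s \<longrightarrow>
          measure_pmf.expectation (batches n b K) (\<lambda>\<omega>. avg n f (x K \<omega>) - avg n f xstar) \<le> \<epsilon>) \<and>
        real (lmo_calls K) \<le>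
          C * (real n / real b * ln (1 / \<epsilon>)
               + (1 + L_tilde n Ls * sqrt (real n) / (real b * L)) * (L * D\<^sup>2 / \<epsilon>)) \<and>
        real (oracle_calls n b K) \<le>
          C * (real n * ln (1 / \<epsilon>)
               + (real b + L_tilde n Ls * sqrt (real n) / L) * (L * D\<^sup>2 / \<epsilon>))))"
proof (rule exI[of _ "5000 :: real"], intro conjI allI impI)
  show "(0 :: real) < 5000" by simp
next
  fix d n b :: nat and X f L Ls D xstar x0
  assume problem: "fw_problem d n X f L Ls D"
    and xstar: "is_arg_min (avg n f) (\<lambda>x. x \<in> X) xstar"
    and x0: "x0 \<in> X" and b: "1 \<le> b" "b \<le> n"
  define F0 where "F0 = avg n f x0 - avg n f xstar"
  define a where "a = 8 * real n / real b"
  define Lt where "Lt = L_tilde n Ls"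
  define Q where "Q = L / 2 + 63 * Lt * sqrt (real n) / real b"
  have F0: "F0 \<ge> 0" using xstar x0 by (auto simp: F0_def is_arg_min_def not_less)
  have n: "n \<ge> 1" using b by simp
  have L: "L > 0" and D: "D > 0" using problem by (auto simp: fw_problem_def smooth_wrt_def)
  have Lt: "Lt \<ge> 0" by (simp add: Lt_def L_tilde_def sum_nonneg)
  have a: "a \<ge> 8" using b by (auto simp: a_def field_simps)
  have Q: "Q > 0" using L Lt by (simp add: Q_def add_pos_nonneg)
  \<comment> \<open>\<open>\<epsilon> \<le> exp (-1)\<close> gives \<open>ln (1 / \<epsilon>) \<ge> 1\<close>, which absorbs additive constants;
    the second bound controls the initial suboptimality, since \<open>2 * \<epsilon>\<^sup>2 * F0 \<le> \<epsilon> / 2\<close>.\<close>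
  define \<epsilon>0 where "\<epsilon>0 = min (exp (-1)) (1 / (4 * F0 + 1))"
  show "\<exists>\<epsilon>0>0. \<forall>\<epsilon>. 0 < \<epsilon> \<and> \<epsilon> \<le> \<epsilon>0 \<longrightarrow>
      (\<exists>K.
        (\<forall>x g y s.
          saga_sarah_fw_run d n X f x0 b (real b / (2 * real n)) (step_size n b K) K x g y s \<longrightarrow>
          measure_pmf.expectation (batches n b K) (\<lambda>\<omega>. avg n f (x K \<omega>) - avg n f xstar) \<le> \<epsilon>) \<and>
        real (lmo_calls K) \<le>
          5000 * (real n / real b * ln (1 / \<epsilon>)
               + (1 + L_tilde n Ls * sqrt (real n) / (real b * L)) * (L * D\<^sup>2 / \<epsilon>)) \<and>
        real (oracle_calls n b K) \<le>
          5000 * (real n * ln (1 / \<epsilon>)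
               + (real b + L_tilde n Ls * sqrt (real n) / L) * (L * D\<^sup>2 / \<epsilon>)))"
  proof (rule exI[of _ \<epsilon>0], intro conjI allI impI)
    show "\<epsilon>0 > 0" using F0 by (simp add: \<epsilon>0_def)
  next
    fix \<epsilon> :: real assume "0 < \<epsilon> \<and> \<epsilon> \<le> \<epsilon>0"
    then have \<epsilon>: "\<epsilon> > 0" "\<epsilon> \<le> exp (-1)" "\<epsilon> \<le> 1 / (4 * F0 + 1)" by (auto simp: \<epsilon>0_def)
    define l where "l = ln (1 / \<epsilon>)"
    have l: "l \<ge> 1"
      using \<epsilon> by (simp add: l_def ln_div) (metis ln_exp ln_le_cancel_iff exp_gt_zero minus_le_iff)
    \<comment> \<open>The two summands of \<open>r\<close> make the two error terms at most \<open>\<epsilon> / 2\<close> each.\<close>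
    define r where "r = 2 * a * l + 32 * Q * D\<^sup>2 / \<epsilon>"
    define K where "K = nat \<lceil>r\<rceil>"
    have "2 * a \<le> 2 * a * l" using a l by simp
    moreover have "32 * Q * D\<^sup>2 / \<epsilon> \<ge> 0" using Q \<epsilon> by simp
    ultimately have r: "r \<ge> 2 * a" "2 * a * l \<le> r" "32 * Q * D\<^sup>2 / \<epsilon> \<le> r" "r > 0"
      using a unfolding r_def by linarith+
    have Kr: "r \<le> real K" "real K \<le> r + 1" using r by (auto simp: K_def)
    have K: "K > 0" using Kr r by (metis gr0I of_nat_0 less_le_trans less_irrefl)
    have Kbig: "real K > 4 * real n / real b"
      using Kr r a by (simp add: a_def)
    have bound: "2 * exp (- real K / a) * F0 + 16 * Q * D\<^sup>2 / real K \<le> \<epsilon>"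
    proof -
      have "2 * l \<le> real K / a" using a Kr r by (simp add: pos_le_divide_eq mult_ac)
      then have "exp (- real K / a) \<le> exp (- (2 * l))" by simp
      also have "exp (- (2 * l)) = \<epsilon> * \<epsilon>"
      proof -
        have "exp (- l) = \<epsilon>" using \<epsilon> by (simp add: l_def ln_div)
        then show ?thesis using exp_add[of "- l" "- l"] by simp
      qed
      finally have "2 * exp (- real K / a) * F0 \<le> 2 * (\<epsilon> * \<epsilon>) * F0"
        using F0 by (intro mult_right_mono) auto
      also have "\<dots> \<le> \<epsilon> / 2"
      proof -
        have "\<epsilon> * (4 * F0 + 1) \<le> 1" using \<epsilon> F0 by (simp add: pos_le_divide_eq)
        then have "\<epsilon> * (4 * F0) \<le> 1" using \<epsilon> by (simp add: distrib_left)
        then have "\<epsilon> / 2 * (\<epsilon> * (4 * F0)) \<le> \<epsilon> / 2 * 1" using \<epsilon> by (intro mult_left_mono) auto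
        moreover have "2 * (\<epsilon> * \<epsilon>) * F0 = \<epsilon> / 2 * (\<epsilon> * (4 * F0))" by simp
        ultimately show ?thesis by linarith
      qed
      finally have 1: "2 * exp (- real K / a) * F0 \<le> \<epsilon> / 2" .
      have "32 * Q * D\<^sup>2 / \<epsilon> \<le> real K" using Kr r by linarith
      then have "16 * Q * D\<^sup>2 / real K \<le> \<epsilon> / 2"
        using \<epsilon> K by (simp add: field_simps)
      with 1 show ?thesis by linarith
    qed
    define T where "T = (1 + Lt * sqrt (real n) / (real b * L)) * (L * D\<^sup>2 / \<epsilon>)"
    define p where "p = real n / real b * l"
    have p: "p \<ge> 1"
      using mult_mono[of 1 "real n / real b" 1 l] b l by (simp add: p_def)
    have lmo: "real K \<le> 17 * p + 2016 * T"
    proof -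
      have "32 * Q * D\<^sup>2 / \<epsilon> \<le> 2016 * T"
      proof -
        have "32 * Q * D\<^sup>2 / \<epsilon> = (16 * L + 2016 * (Lt * sqrt (real n) / real b)) * (D\<^sup>2 / \<epsilon>)"
          by (simp add: Q_def)
        also have "\<dots> \<le> (2016 * L + 2016 * (Lt * sqrt (real n) / real b)) * (D\<^sup>2 / \<epsilon>)"
          using L \<epsilon> by (intro mult_right_mono) auto
        also have "\<dots> = 2016 * T"
          using L by (simp add: T_def field_simps)
        finally show ?thesis .
      qed
      moreover have "r = 16 * p + 32 * Q * D\<^sup>2 / \<epsilon>"
        by (simp add: r_def a_def p_def)
      ultimately show ?thesis using p Kr(2) by linarith
    qed
    have T: "T \<ge> 0" using Lt L \<epsilon> by (simp add: T_def)
    have bT: "(real b + Lt * sqrt (real n) / L) * (L * D\<^sup>2 / \<epsilon>) = real b * T"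
    proof -
      have "real b > 0" using b by simp
      then have "real b * (1 + Lt * sqrt (real n) / (real b * L)) = real b + Lt * sqrt (real n) / L"
        using L by (simp add: field_simps)
      then show ?thesis by (metis T_def mult.assoc)
    qed
    show "\<exists>K.
        (\<forall>x g y s.
          saga_sarah_fw_run d n X f x0 b (real b / (2 * real n)) (step_size n b K) K x g y s \<longrightarrow>
          measure_pmf.expectation (batches n b K) (\<lambda>\<omega>. avg n f (x K \<omega>) - avg n f xstar) \<le> \<epsilon>) \<and>
        real (lmo_calls K) \<le>
          5000 * (real n / real b * ln (1 / \<epsilon>)
               + (1 + L_tilde n Ls * sqrt (real n) / (real b * L)) * (L * D\<^sup>2 / \<epsilon>)) \<and>
        real (oracle_calls n b K) \<le>
          5000 * (real n * ln (1 / \<epsilon>)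
               + (real b + L_tilde n Ls * sqrt (real n) / L) * (L * D\<^sup>2 / \<epsilon>))"
      unfolding Lt_def[symmetric] l_def[symmetric] bT T_def[symmetric] p_def[symmetric]
    proof (rule exI[of _ K], intro conjI allI impI)
      fix x g y s
      assume run: "saga_sarah_fw_run d n X f x0 b (real b / (2 * real n)) (step_size n b K) K x g y s"
      have step: "step_size n b K k = 2 / (a + real (k - (K + 1) div 2))" for k
        unfolding a_def by (rule step_size_eq[OF Kbig b(1) n])
      interpret saga_sarah_fw d n X f L Ls D x0 b "real b / (2 * real n)" "step_size n b K" K x g y s
        using problem x0 b run a by unfold_locales (auto simp: step)
      show "measure_pmf.expectation (batches n b K) (\<lambda>\<omega>. avg n f (x K \<omega>) - avg n f xstar) \<le> \<epsilon>"
        using expected_suboptimality_le[OF refl K _ xstar] step bound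
        by (simp add: a_def F0_def Q_def Lt_def)
    next
      show "real (lmo_calls K) \<le> 5000 * (p + T)"
        using lmo p T unfolding lmo_calls_def distrib_left by linarith
    next
      have "real b * real K \<le> real b * (17 * p + 2016 * T)"
        using lmo by (intro mult_left_mono) auto
      also have "\<dots> = 17 * (real n * l) + 2016 * (real b * T)"
        using b by (simp add: p_def field_simps)
      finally have "real b * real K \<le> 17 * (real n * l) + 2016 * (real b * T)" .
      moreover have "real n \<le> real n * l" using l n by simp
      moreover have "0 \<le> real b * T" using T by simp
      ultimately show "real (oracle_calls n b K) \<le> 5000 * (real n * l + real b * T)"
        unfolding oracle_calls_def distrib_left by simp
    qed
  qed
qed

end
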